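(* For every $j\in\{1,2,3\}$, every $\boldsymbol{x}_*=(x_{*1},x_{*2},x_{*3})\in D$ and every $\boldsymbol{z}=(z_1,z_2,z_3)\in W$ with $x_{*3}\neq z_3$, $$\mathcal{H}\Psi(\boldsymbol{x}_*;\boldsymbol{z})\boldsymbol{e}_j=\begin{cases}\Big(\Re[\partial_{x_{*3}}\mathbb{G}_e(\boldsymbol{x}_*;\boldsymbol{z})]\,\boldsymbol{e}_j\Big)_{\mathrm{prop.}}, & x_{*3}<z_3,\\[2mm] \Big(\Re[\partial_{z_3}\mathbb{G}_e(\boldsymbol{x}_*;\boldsymbol{z})]\,\boldsymbol{e}_j\Big)_{\mathrm{prop.}}, & x_{*3}>z_3,\end{cases}$$ where "prop." denotes the projection onto the subspace spanned by the propagating modes, and $\mathcal{H},\Psi,\mathbb{G}_e$ are as defined in the context.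
   Context: **Waveguide.** Let $a,b>0$, $\Sigma=(0,a)\times(0,b)$, $W=\Sigma\times(-\infty,0)$. Points are $\boldsymbol{x}=(x_1,x_2,x_3)$, $\widehat{x}=(x_1,x_2)$, $\boldsymbol{x}^-=(x_1,x_2,-x_3)$; $k>0$ is the wavenumber; $T$ denotes transpose without conjugation; overline denotes complex conjugation and $\Re$ the (entrywise) real part; $\nu$ is the unit outward normal; $\boldsymbol{e}_1,\boldsymbol{e}_2,\boldsymbol{e}_3$ is the standard basis of $\mathbb{R}^3$. **Modes.** For integers $m_1,m_2\ge 0$ let $u_m(\widehat{x})=\alpha_m\cos(\frac{m_1\pi x_1}{a})\cos(\frac{m_2\pi x_2}{b})$, $\lambda_m\ge0$, $\lambda_m^2=(\frac{m_1\pi}{a})^2+(\frac{m_2\pi}{b})^2$, enumerated by $m=0,1,2,\dots$ with $\lambda_m\le\lambda_{m+1}$ (so $m=0$ is $(0,0)$). For integers $n_1,n_2\ge1$ let $v_n(\widehat{x})=\beta_n\sin(\frac{n_1\pi x_1}{a})\sin(\frac{n_2\pi x_2}{b})$, $\mu_n>0$, $\mu_n^2=(\frac{n_1\pi}{a})^2+(\frac{n_2\pi}{b})^2$, enumerated by $n=1,2,\dots$ with $\mu_n\le\mu_{n+1}$. The constants $\alpha_m,\beta_n>0$ are such that $u_m,v_n$ have unit $L^2(\Sigma)$ norm. Assume $k^2\ne\lambda_m^2,\mu_n^2$ for all $m,n$. Let $h_m=\sqrt{k^2-\lambda_m^2}$, $g_n=\sqrt{k^2-\mu_n^2}$ (positive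 if the radicand is positive, in $i(0,\infty)$ if it is negative), and $$M_m(\boldsymbol{x})=(\partial_2u_m,-\partial_1u_m,0)^Te^{ih_mx_3},\quad P_n(\boldsymbol{x})=\tfrac1k(ig_n\partial_1v_n,ig_n\partial_2v_n,0)^Te^{ig_nx_3},\quad Q_n(\boldsymbol{x})=\tfrac1k(0,0,\mu_n^2v_n)^Te^{ig_nx_3}.$$ Let $M,N$ be the indices with $\lambda_M<k<\lambda_{M+1}$ and $\mu_N<k<\mu_{N+1}$ (an empty sum is zero). The modes with $m\le M$ and $n\le N$ (real $h_m$, $g_n$) are the propagating modes; the others are evanescent. **Dyadic Green function.** $\mathbb{G}_e(\boldsymbol{x};\boldsymbol{y})$ is the ($3\times3$-matrix valued) electric dyadic Green function of $W$, i.e. the solution of $\mathrm{curl}_{\boldsymbol{x}}^2\mathbb{G}_e-k^2\mathbb{G}_e=\delta(\boldsymbol{x}-\boldsymbol{y})\boldsymbol{I}$ in $W$, $\nu\times\mathbb{G}_e=0$ on $\partial W$, that for $x_3\ll-1$ is a superposition of the fields $M_m(\boldsymbol{x}^-)$ and $P_n(\boldsymbol{x}^-)-Q_n(\boldsymbol{x}^-)$. With $c_m=\frac{i}{2h_m\lambda_m^2}$, $d_n=-\frac{i}{2g_n\mu_n^2}$ it is given for $x_3>y_3$ by $$\mathbb{G}_e(\boldsymbol{x};\boldsymbol{y})=\sum_{m\ge1}c_m[M_m(\boldsymbol{x})-M_m(\boldsymbol{x}^-)]M_m^T(\boldsymbol{y}^-)+\sum_{n\ge1}d_n\big([P_n(\boldsymbol{x})-P_n(\boldsymbol{x}^-)]+[Q_n(\boldsymbol{x})+Q_n(\boldsymbol{x}^-)]\big)[P_n(\boldsymbol{y}^-)-Q_n(\boldsymbol{y}^-)]^T,$$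 and for $x_3<y_3$ by $$\mathbb{G}_e(\boldsymbol{x};\boldsymbol{y})=\sum_{m\ge1}c_mM_m(\boldsymbol{x}^-)[M_m(\boldsymbol{y})-M_m(\boldsymbol{y}^-)]^T+\sum_{n\ge1}d_n[P_n(\boldsymbol{x}^-)-Q_n(\boldsymbol{x}^-)]\big([P_n(\boldsymbol{y})-P_n(\boldsymbol{y}^-)]+[Q_n(\boldsymbol{y})+Q_n(\boldsymbol{y}^-)]\big)^T.$$ The projection "prop." of $\Re[\partial\mathbb{G}_e]\boldsymbol{e}_j$ keeps, in the (termwise differentiated) modal series, exactly the terms with $m\le M$ and $n\le N$. **Scatterer and measurement surface.** $D\subset W$ is a bounded open Lipschitz domain. The measurement surface is $\Sigma_r=\Sigma\times\{r\}$, $r<0$, with $D\subset\Sigma\times(r,0)$ and $D$ at positive distance from $\Sigma_r$. $\boldsymbol{L}^2_t(\Sigma_r)=\{\boldsymbol{u}\in(L^2(\Sigma_r))^3:\boldsymbol{u}\cdot\nu=0\}$. **Operator $\mathcal{H}$ and test function.** For $\boldsymbol{g}\in\boldsymbol{L}^2_t(\Sigma_r)$, $(\mathcal{H}\boldsymbol{g})(\boldsymbol{x})=\int_{\Sigma_r}\mathbb{G}_e(\boldsymbol{x};\boldsymbol{y})\boldsymbol{g}(\boldsymbol{y})\,dS_{\boldsymbol{y}}$, $\boldsymbol{x}\in D$. The matrix-valued function $\Psi$ is, for $\boldsymbol{y}\in\Sigma_r$, $$\Psi(\boldsymbol{y};\boldsymbol{z})=\sum_{m=1}^M(-i)\frac{h_m}{2\lambda_m^2}\overline{M}_m(\boldsymbol{y}^-)[\overline{M}_m(\boldsymbol{z})-\overline{M}_m(\boldsymbol{z}^-)]^T+\sum_{n=1}^N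 i\frac{k^2}{2\mu_n^2g_n}\overline{P}_n(\boldsymbol{y}^-)\big([\overline{P}_n(\boldsymbol{z})-\overline{P}_n(\boldsymbol{z}^-)]^T+[\overline{Q}_n(\boldsymbol{z})+\overline{Q}_n(\boldsymbol{z}^-)]^T\big).$$ $\mathcal{H}\Psi(\boldsymbol{x}_*;\boldsymbol{z})\boldsymbol{e}_j$ means the value at $\boldsymbol{x}_*$ of $\mathcal{H}$ applied to $\boldsymbol{y}\mapsto\Psi(\boldsymbol{y};\boldsymbol{z})\boldsymbol{e}_j$. *)

theory Defs
  imports "HOL-Analysis.Analysis"
begin

text \<open>Near each boundary point, after a rotation, the set is the strict epigraph of a Lipschitz
  function (which absorbs any translation). Connectedness is not required.\<close>

definition lipschitz_domain :: "(real^3) set \<Rightarrow> bool" where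
  "lipschitz_domain D \<longleftrightarrow> open D \<and>
    (\<forall>p\<in>frontier D. \<exists>U (T :: real^3 \<Rightarrow> real^3) (\<phi> :: real \<times> real \<Rightarrow> real) L.
        open U \<and> p \<in> U \<and> orthogonal_transformation T \<and> lipschitz_on L UNIV \<phi> \<and>
        D \<inter> U = {x \<in> U. \<phi> (T x $ 1, T x $ 2) < T x $ 3})"

definition mirror :: "real^3 \<Rightarrow> real^3" where
  "mirror x = vector [x$1, x$2, - x$3]"

definition with_x3 :: "real^3 \<Rightarrow> real \<Rightarrow> real^3" where
  "with_x3 x t = vector [x$1, x$2, t]"

text \<open>\<open>outer v w\<close> is the matrix \<open>v w\<^sup>T\<close>, without conjugation.\<close>

definition outer :: "complex^3 \<Rightarrow> complex^3 \<Rightarrow> complex^3^3" where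
  "outer v w = (\<chi> i j. v$i * w$j)"

definition cnj_vec :: "complex^3 \<Rightarrow> complex^3" where
  "cnj_vec v = (\<chi> i. cnj (v$i))"

text \<open>The entrywise real part, again regarded as a complex matrix.\<close>

definition Re_mat :: "complex^3^3 \<Rightarrow> complex^3^3" where
  "Re_mat A = (\<chi> i j. complex_of_real (Re (A$i$j)))"

text \<open>A modal series has one term for each index \<open>m \<ge> 1\<close> (fields \<open>M\<^sub>m\<close>) and one for each index
  \<open>n \<ge> 1\<close> (fields \<open>P\<^sub>n, Q\<^sub>n\<close>). Its propagating part keeps the terms with \<open>m \<le> M\<close>, \<open>n \<le> N\<close>.\<close>

definition modal_series ::
  "(nat \<Rightarrow> 'v) \<Rightarrow> (nat \<Rightarrow> 'v) \<Rightarrow> 'v::{topological_space, comm_monoid_add}" where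
  "modal_series A B = (\<Sum>m. A (Suc m)) + (\<Sum>n. B (Suc n))"

definition propagating_part ::
  "nat \<Rightarrow> nat \<Rightarrow> (nat \<Rightarrow> 'v) \<Rightarrow> (nat \<Rightarrow> 'v) \<Rightarrow> 'v::comm_monoid_add" where
  "propagating_part M N A B = (\<Sum>m=1..M. A m) + (\<Sum>n=1..N. B n)"

text \<open>The parameters of the locale are the side lengths \<open>a, b\<close>, the wavenumber \<open>k\<close>, and the
  enumerations \<open>mi\<close> of the pairs \<open>(m\<^sub>1, m\<^sub>2)\<close> and \<open>ni\<close> of the pairs \<open>(n\<^sub>1, n\<^sub>2)\<close>. The locale makes no
  assumptions. The value \<open>ni 0\<close> is never used: the second family is enumerated by \<open>n \<ge> 1\<close>.\<close>

locale waveguide =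
  fixes a b k :: real and mi ni :: "nat \<Rightarrow> nat \<times> nat"
begin

definition cross_section :: "(real \<times> real) set" where
  "cross_section = {0<..<a} \<times> {0<..<b}"

definition guide :: "(real^3) set" where
  "guide = {x. (x$1, x$2) \<in> cross_section \<and> x$3 < 0}"

text \<open>The normalisation constant of \<open>f\<close> in \<open>L\<^sup>2(\<Sigma>)\<close>.\<close>

definition unit_const :: "(real \<Rightarrow> real \<Rightarrow> real) \<Rightarrow> real" where
  "unit_const f = (THE c. c > 0 \<and> (LINT s:cross_section|lborel. (c * f (fst s) (snd s))\<^sup>2) = 1)"

definition cos_mode :: "nat \<Rightarrow> real \<Rightarrow> real \<Rightarrow> real" where
  "cos_mode m s t =
     cos (real (fst (mi m)) * pi * s / a) * cos (real (snd (mi m)) * pi * t / b)"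

definition sin_mode :: "nat \<Rightarrow> real \<Rightarrow> real \<Rightarrow> real" where
  "sin_mode n s t =
     sin (real (fst (ni n)) * pi * s / a) * sin (real (snd (ni n)) * pi * t / b)"

definition u :: "nat \<Rightarrow> real \<Rightarrow> real \<Rightarrow> real" where
  "u m s t = unit_const (cos_mode m) * cos_mode m s t"

definition v :: "nat \<Rightarrow> real \<Rightarrow> real \<Rightarrow> real" where
  "v n s t = unit_const (sin_mode n) * sin_mode n s t"

definition lam :: "nat \<Rightarrow> real" where
  "lam m = sqrt ((real (fst (mi m)) * pi / a)\<^sup>2 + (real (snd (mi m)) * pi / b)\<^sup>2)"

definition mu :: "nat \<Rightarrow> real" where
  "mu n = sqrt ((real (fst (ni n)) * pi / a)\<^sup>2 + (real (snd (ni n)) * pi / b)\<^sup>2)"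

text \<open>On the real axis \<open>csqrt\<close> has the required branch: values in \<open>(0,\<infinity>)\<close> on positive and in
  \<open>i(0,\<infinity>)\<close> on negative arguments.\<close>

definition h :: "nat \<Rightarrow> complex" where
  "h m = csqrt (complex_of_real (k\<^sup>2 - (lam m)\<^sup>2))"

definition g :: "nat \<Rightarrow> complex" where
  "g n = csqrt (complex_of_real (k\<^sup>2 - (mu n)\<^sup>2))"

definition field_M :: "nat \<Rightarrow> real^3 \<Rightarrow> complex^3" where
  "field_M m x = exp (\<i> * h m * of_real (x$3)) *s
     vector [of_real (deriv (\<lambda>t. u m (x$1) t) (x$2)),
             - of_real (deriv (\<lambda>s. u m s (x$2)) (x$1)),
             0]"

definition field_P :: "nat \<Rightarrow> real^3 \<Rightarrow> complex^3" where
  "field_P n x = (1 / of_real k * exp (\<i> * g n * of_real (x$3))) *s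
     vector [\<i> * g n * of_real (deriv (\<lambda>s. v n s (x$2)) (x$1)),
             \<i> * g n * of_real (deriv (\<lambda>t. v n (x$1) t) (x$2)),
             0]"

definition field_Q :: "nat \<Rightarrow> real^3 \<Rightarrow> complex^3" where
  "field_Q n x = (1 / of_real k * exp (\<i> * g n * of_real (x$3))) *s
     vector [0, 0, of_real ((mu n)\<^sup>2 * v n (x$1) (x$2))]"

definition coeff_c :: "nat \<Rightarrow> complex" where
  "coeff_c m = \<i> / (2 * h m * of_real ((lam m)\<^sup>2))"

definition coeff_d :: "nat \<Rightarrow> complex" where
  "coeff_d n = - (\<i> / (2 * g n * of_real ((mu n)\<^sup>2)))"

text \<open>The terms of the modal expansion of the electric dyadic Green function. The expansion is meant
  for \<open>x$3 \<noteq> y$3\<close> only; on the plane \<open>x$3 = y$3\<close> the value carries no meaning.\<close>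

definition green_term_M :: "nat \<Rightarrow> real^3 \<Rightarrow> real^3 \<Rightarrow> complex^3^3" where
  "green_term_M m x y =
     (if x$3 > y$3
      then outer (coeff_c m *s (field_M m x - field_M m (mirror x))) (field_M m (mirror y))
      else outer (coeff_c m *s field_M m (mirror x)) (field_M m y - field_M m (mirror y)))"

definition green_term_PQ :: "nat \<Rightarrow> real^3 \<Rightarrow> real^3 \<Rightarrow> complex^3^3" where
  "green_term_PQ n x y =
     (if x$3 > y$3
      then outer (coeff_d n *s ((field_P n x - field_P n (mirror x))
                              + (field_Q n x + field_Q n (mirror x))))
                 (field_P n (mirror y) - field_Q n (mirror y))
      else outer (coeff_d n *s (field_P n (mirror x) - field_Q n (mirror x)))
                 ((field_P n y - field_P n (mirror y)) + (field_Q n y + field_Q n (mirror y))))"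

text \<open>As a distribution, the solution of \<open>curl\<^sup>2 G - k\<^sup>2 G = \<delta> I\<close> is not locally integrable at
  \<open>x = y\<close>. Off the plane \<open>x$3 = y$3\<close> it is the function given by the modal expansion, which is
  taken here as the definition.\<close>

definition green :: "real^3 \<Rightarrow> real^3 \<Rightarrow> complex^3^3" where
  "green x y = modal_series (\<lambda>m. green_term_M m x y) (\<lambda>n. green_term_PQ n x y)"

text \<open>Propagating parts of \<open>Re (\<partial>G(x;z)/\<partial>x\<^sub>3) e\<^sub>j\<close> and \<open>Re (\<partial>G(x;z)/\<partial>z\<^sub>3) e\<^sub>j\<close>, the series being
  differentiated termwise.\<close>

definition prop_Re_green_dx3 :: "nat \<Rightarrow> nat \<Rightarrow> real^3 \<Rightarrow> real^3 \<Rightarrow> 3 \<Rightarrow> complex^3" where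
  "prop_Re_green_dx3 M N x z j = propagating_part M N
     (\<lambda>m. Re_mat (vector_derivative (\<lambda>t. green_term_M m (with_x3 x t) z) (at (x$3))) *v axis j 1)
     (\<lambda>n. Re_mat (vector_derivative (\<lambda>t. green_term_PQ n (with_x3 x t) z) (at (x$3))) *v axis j 1)"

definition prop_Re_green_dz3 :: "nat \<Rightarrow> nat \<Rightarrow> real^3 \<Rightarrow> real^3 \<Rightarrow> 3 \<Rightarrow> complex^3" where
  "prop_Re_green_dz3 M N x z j = propagating_part M N
     (\<lambda>m. Re_mat (vector_derivative (\<lambda>t. green_term_M m x (with_x3 z t)) (at (z$3))) *v axis j 1)
     (\<lambda>n. Re_mat (vector_derivative (\<lambda>t. green_term_PQ n x (with_x3 z t)) (at (z$3))) *v axis j 1)"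

definition slice :: "real \<Rightarrow> (real^3) set" where
  "slice r = {x. (x$1, x$2) \<in> cross_section \<and> x$3 = r}"

text \<open>The surface measure \<open>dS\<close> on the flat surface \<open>\<Sigma>\<^sub>r\<close> is the image of the planar Lebesgue
  measure on \<open>\<Sigma>\<close>.\<close>

definition slice_measure :: "real \<Rightarrow> (real^3) measure" where
  "slice_measure r = distr (restrict_space lborel cross_section)
     (restrict_space borel (slice r)) (\<lambda>s. vector [fst s, snd s, r])"

text \<open>The unit normal of \<open>\<Sigma>\<^sub>r\<close> is \<open>\<plusminus>e\<^sub>3\<close>, so tangential fields are those with vanishing third
  component.\<close>

definition L2t :: "real \<Rightarrow> (real^3 \<Rightarrow> complex^3) set" where
  "L2t r = {f \<in> borel_measurable (slice_measure r).
      integrable (slice_measure r) (\<lambda>y. (norm (f y))\<^sup>2) \<and> (AE y in slice_measure r. f y $ 3 = 0)}"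

text \<open>The operator is \<open>undefined\<close> outside \<open>L2t r\<close>, and its values are functions on \<open>D\<close> only.\<close>

definition op_H :: "real \<Rightarrow> (real^3) set \<Rightarrow> (real^3 \<Rightarrow> complex^3) \<Rightarrow> real^3 \<Rightarrow> complex^3" where
  "op_H r D = (\<lambda>f\<in>L2t r. \<lambda>x\<in>D. LINT y|slice_measure r. green x y *v f y)"

definition Psi :: "nat \<Rightarrow> nat \<Rightarrow> real^3 \<Rightarrow> real^3 \<Rightarrow> complex^3^3" where
  "Psi M N y z =
     (\<Sum>m=1..M. outer ((- \<i> * (h m / (2 * of_real ((lam m)\<^sup>2)))) *s cnj_vec (field_M m (mirror y)))
                      (cnj_vec (field_M m z) - cnj_vec (field_M m (mirror z))))
   + (\<Sum>n=1..N. outer ((\<i> * (of_real (k\<^sup>2) / (2 * of_real ((mu n)\<^sup>2) * g n)))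
                          *s cnj_vec (field_P n (mirror y)))
                      ((cnj_vec (field_P n z) - cnj_vec (field_P n (mirror z)))
                       + (cnj_vec (field_Q n z) + cnj_vec (field_Q n (mirror z)))))"

end

end

(* Multiplying the modal series of the Green function by the source Psi e_j and integrating over
   the cross-section kills every evanescent term, because the tangential profiles rot u_m and
   grad v_n are pairwise orthogonal in L^2 and Psi contains propagating ones only. Termwise
   integration is legitimate since the source plane lies strictly below x: the m-th evanescent term
   decays like exp (-|h_m| (x_3 - r)). For a propagating mode the side of the Green function that
   is differentiated is a single exponential exp (-i h_m t), so the derivative is multiplication by
   -i h_m; with standing waves 2i sin (h_m t) on the other side, both sides of the claim become
   sin (h_m x_3) sin (h_m z_3) / lambda_m^2 times the profiles, and similarly for P_n, Q_n. *)

theory Submission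
  imports Defs
begin

text \<open>Convergence rests on the lattice of index pairs, not on the growth of
  \<open>lam m\<close> in m: sums over an enumeration are bounded by sums over pairs, products of
  two geometric series. The x-factor of an evanescent term grows like exp (-\<eta> x_3), as x_3 < 0;
  only its product with the factor on the slice decays, so the majorants bound products of norms.
  All fields are split into real profiles times complex scalars, which makes the orthogonality
  integrals real. The real part in the claim is computable because -i h_m c_m = 1/(2 lambda_m^2) and
  -i g_n d_n = -1/(2 mu_n^2) are real, and because P_n(y^-) - Q_n(y^-) has real part minus half the
  standing wave. Hence both cases of the claim give one expression, symmetric under exchange of (x,
  i) and (z, j), where i is the component. The weights h_m and k^2/g_n in Psi cancel 1/h_m and
  (g_n/k)^2/g_n, which come from the coefficients and the two tangential amplitudes; r drops out
  since exp (-i h_m r) has modulus one for real h_m. The source is tangential, so Q_n enters only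
  through the standing waves.\<close>

section \<open>Summation over pairs of wavenumbers\<close>

text \<open>A partial sum over the enumeration lies inside a finite square of pairs, where the sum
  factors into two geometric sums; the bound does not depend on the order of the
  enumeration.\<close>

lemma summable_two_index_geometric:
  fixes p :: "nat \<Rightarrow> nat \<times> nat" and \<rho> \<sigma> :: real
  assumes p: "inj p" and "0 \<le> \<rho>" "\<rho> < 1" "0 \<le> \<sigma>" "\<sigma> < 1"
  shows "summable (\<lambda>m. \<rho> ^ fst (p m) * \<sigma> ^ snd (p m))"
proof (rule summableI_nonneg_bounded)
  fix n
  obtain K where K: "p ` {..<n} \<subseteq> {..<K} \<times> {..<K}"
  proof -
    define K where "K = Suc (Max ((\<lambda>m. max (fst (p m)) (snd (p m))) ` {..<n}))"
    have "max (fst (p m)) (snd (p m)) < K" if "m < n" for m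
      unfolding K_def less_Suc_eq_le using that by (intro Max_ge) auto
    then have "p ` {..<n} \<subseteq> {..<K} \<times> {..<K}"
      by (auto simp: mem_Times_iff) (metis fst_conv snd_conv)+
    then show ?thesis using that by blast
  qed
  have geo: "(\<Sum>i<K. x ^ i) \<le> 1 / (1 - x)" if "0 \<le> x" "x < 1" for x :: real
    using that sum_le_suminf[of "\<lambda>i. x ^ i" "{..<K}"] suminf_geometric[of x] summable_geometric[of x] by simp
  have "(\<Sum>m<n. \<rho> ^ fst (p m) * \<sigma> ^ snd (p m)) = (\<Sum>q\<in>p ` {..<n}. \<rho> ^ fst q * \<sigma> ^ snd q)"
    using p by (subst sum.reindex) (auto intro: inj_on_subset)
  also have "\<dots> \<le> (\<Sum>q\<in>{..<K} \<times> {..<K}. \<rho> ^ fst q * \<sigma> ^ snd q)"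
    using K assms by (intro sum_mono2) auto
  also have "\<dots> = (\<Sum>i<K. \<rho> ^ i) * (\<Sum>j<K. \<sigma> ^ j)"
    by (simp add: sum_product sum.cartesian_product case_prod_unfold)
  also have "\<dots> \<le> 1 / (1 - \<rho>) * (1 / (1 - \<sigma>))"
    using assms by (intro mult_mono geo sum_nonneg) auto
  finally show "(\<Sum>m<n. \<rho> ^ fst (p m) * \<sigma> ^ snd (p m)) \<le> 1 / (1 - \<rho>) * (1 / (1 - \<sigma>))" .
qed (use assms in auto)

text \<open>The inequality \<open>(s + t) / 2 \<le> sqrt (s\<^sup>2 + t\<^sup>2)\<close> splits the
  exponential into powers of two ratios below 1, one for each index of the pair; it is also the
  origin of the halved rate in these ratios.\<close>

lemma summable_exp_wavenumbers:
  fixes p :: "nat \<Rightarrow> nat \<times> nat" and a b \<delta> :: real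
  assumes p: "inj p" and pos: "a > 0" "b > 0" "\<delta> > 0"
  shows "summable (\<lambda>m. exp (- \<delta> * sqrt ((real (fst (p m)) * pi / a)\<^sup>2 + (real (snd (p m)) * pi / b)\<^sup>2)))"
proof (rule summable_comparison_test')
  let ?\<rho> = "exp (- \<delta> / 2 * (pi / a))" and ?\<sigma> = "exp (- \<delta> / 2 * (pi / b))"
  show "summable (\<lambda>m. ?\<rho> ^ fst (p m) * ?\<sigma> ^ snd (p m))"
    using pos by (intro summable_two_index_geometric p) auto
  fix m :: nat
  let ?s = "real (fst (p m)) * pi / a" and ?t = "real (snd (p m)) * pi / b"
  have "?s \<le> sqrt (?s\<^sup>2 + ?t\<^sup>2)" "?t \<le> sqrt (?s\<^sup>2 + ?t\<^sup>2)"
    by (auto intro: real_le_rsqrt)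
  moreover have "(s + t) / 2 \<le> q" if "s \<le> q" "t \<le> q" for s t q :: real
    using that by simp
  ultimately have "(?s + ?t) / 2 \<le> sqrt (?s\<^sup>2 + ?t\<^sup>2)"
    by blast
  then have "- \<delta> * sqrt (?s\<^sup>2 + ?t\<^sup>2) \<le> - \<delta> * ((?s + ?t) / 2)"
    using pos by (intro mult_left_mono_neg) simp_all
  also have "\<dots> = real (fst (p m)) * (- \<delta> / 2 * (pi / a)) + real (snd (p m)) * (- \<delta> / 2 * (pi / b))"
    by (simp add: field_simps)
  finally have "exp (- \<delta> * sqrt (?s\<^sup>2 + ?t\<^sup>2)) \<le> exp \<dots>"
    by simp
  then show "norm (exp (- \<delta> * sqrt (?s\<^sup>2 + ?t\<^sup>2))) \<le> ?\<rho> ^ fst (p m) * ?\<sigma> ^ snd (p m)"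
    by (simp only: exp_of_nat_mult exp_add) simp
qed

text \<open>Half of the decay rate absorbs the square: exp t >= t^2/2 at t = \<delta> l / 2 gives
  l^2 <= (8 / \<delta>^2) exp (\<delta> l / 2). This serves the axial fields, whose amplitude grows
  like mu^2.\<close>

lemma summable_square_exp:
  fixes l :: "nat \<Rightarrow> real"
  assumes "\<And>d. d > 0 \<Longrightarrow> summable (\<lambda>m. exp (- d * l m))" "\<delta> > 0" "\<And>m. l m \<ge> 0"
  shows "summable (\<lambda>m. (l m)\<^sup>2 * exp (- \<delta> * l m))"
proof (rule summable_comparison_test')
  show "summable (\<lambda>m. 8 / \<delta>\<^sup>2 * exp (- (\<delta> / 2) * l m))"
    using assms by (intro summable_mult assms) auto
  fix m :: nat
  have "(\<delta> / 2 * l m)\<^sup>2 / 2 \<le> exp (\<delta> / 2 * l m)"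
    using exp_lower_Taylor_quadratic[of "\<delta> / 2 * l m"] assms(2) assms(3)[of m]
    by (smt (verit) divide_nonneg_nonneg mult_nonneg_nonneg)
  then have "(l m)\<^sup>2 \<le> 8 / \<delta>\<^sup>2 * exp (\<delta> / 2 * l m)"
    using assms(2) by (simp add: field_simps power2_eq_square)
  then have "(l m)\<^sup>2 * exp (- \<delta> * l m) \<le> 8 / \<delta>\<^sup>2 * exp (\<delta> / 2 * l m) * exp (- \<delta> * l m)"
    by (intro mult_right_mono) auto
  also have "\<dots> = 8 / \<delta>\<^sup>2 * exp (- (\<delta> / 2) * l m)"
    by (simp add: mult.assoc flip: exp_add)
  finally show "norm ((l m)\<^sup>2 * exp (- \<delta> * l m)) \<le> 8 / \<delta>\<^sup>2 * exp (- (\<delta> / 2) * l m)"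
    by simp
qed

section \<open>Integration of series of dyads\<close>

text \<open>Bilinear, not sesquilinear: the dyads are v w^T without conjugation, so a dyad applied
  to f is \<open>dotc w f\<close> times v.\<close>

definition dotc :: "complex^3 \<Rightarrow> complex^3 \<Rightarrow> complex" where
  "dotc v w = (\<Sum>i\<in>UNIV. v$i * w$i)"

text \<open>Separates the real profile of a mode from its complex amplitude, so that
  \<open>dotc\<close> of two modes is a complex factor times a real inner product.\<close>

definition cvec :: "real^3 \<Rightarrow> complex^3" where
  "cvec w = (\<chi> i. of_real (w$i))"

lemma dotc_scaled_cvec: "dotc (c *s cvec v) (d *s cvec w) = c * d * of_real (v \<bullet> w)"
  by (simp add: dotc_def cvec_def inner_vec_def sum_distrib_left mult_ac)

lemma dotc_add_right: "dotc v (w + w') = dotc v w + dotc v w'"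
  by (simp add: dotc_def algebra_simps sum.distrib)

lemma dotc_sum_right: "dotc v (\<Sum>i\<in>I. w i) = (\<Sum>i\<in>I. dotc v (w i))"
  unfolding dotc_def by (simp add: sum_distrib_left) (rule sum.swap)

lemma norm_cvec [simp]: "norm (cvec w) = norm w"
  by (simp add: cvec_def norm_vec_def)

lemma norm_vector_scalar_mult_complex [simp]: "norm (c *s v) = norm c * norm v" for v :: "complex^3"
  by (simp add: norm_vec_def norm_mult L2_set_right_distrib)

lemma norm_outer: "norm (outer v w) = norm v * norm w"
proof -
  have "outer v w $ i = v $ i *s w" for i
    by (simp add: outer_def vec_eq_iff)
  then have "norm (outer v w) = L2_set (\<lambda>i. norm (v $ i) * norm w) UNIV"
    by (simp add: norm_vec_def[of "outer v w"])
  also have "\<dots> = norm v * norm w"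
    by (simp add: norm_vec_def[of v] L2_set_left_distrib)
  finally show ?thesis .
qed

lemma outer_mult_vec: "outer v w *v f = dotc w f *s v"
  by (simp add: vec_eq_iff matrix_vector_mult_def outer_def dotc_def sum_distrib_left mult_ac)

lemma norm_dotc_le: "norm (dotc v w) \<le> 3 * (norm v * norm w)"
proof -
  have "norm (dotc v w) \<le> (\<Sum>i\<in>(UNIV::3 set). norm v * norm w)"
    unfolding dotc_def
    by (rule sum_norm_le) (simp add: norm_mult mult_mono Finite_Cartesian_Product.norm_nth_le)
  then show ?thesis by simp
qed

lemma bounded_linear_mult_vec: "bounded_linear (\<lambda>A::complex^3^3. A *v f)"
  unfolding linear_conv_bounded_linear[symmetric]
  by (rule linearI) (simp_all add: vec_eq_iff matrix_vector_mult_def algebra_simps sum.distrib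
      scaleR_sum_right)

lemma bounded_linear_scale_vec: "bounded_linear (\<lambda>c::complex. c *s (v :: complex^3))"
  unfolding linear_conv_bounded_linear[symmetric]
  by (rule linearI) (simp_all add: vec_eq_iff algebra_simps)

lemma suminf_Suc_eq_sum:
  fixes f :: "nat \<Rightarrow> 'a::{t2_space, comm_monoid_add}"
  assumes "\<And>m. m > n \<Longrightarrow> f m = 0"
  shows "(\<Sum>m. f (Suc m)) = (\<Sum>m=1..n. f m)"
proof -
  have "(\<Sum>m. f (Suc m)) = (\<Sum>m<n. f (Suc m))"
    using assms by (intro suminf_finite) auto
  also have "\<dots> = (\<Sum>m=1..n. f m)"
    using sum.atLeast1_atMost_eq[of f n] by simp
  finally show ?thesis .
qed

lemma borel_measurable_vec3:
  fixes f :: "'a \<Rightarrow> complex^3"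
  assumes "\<And>i. (\<lambda>x. f x $ i) \<in> borel_measurable M"
  shows "f \<in> borel_measurable M"
proof -
  have "f = (\<lambda>x. \<Sum>i\<in>UNIV. f x $ i *s axis i 1)"
    by (simp add: fun_eq_iff basis_expansion)
  moreover have "(\<lambda>x. f x $ i *s (axis i 1 :: complex^3)) \<in> borel_measurable M" for i
    using measurable_compose[OF assms borel_measurable_continuous_onI[OF
          linear_continuous_on[OF bounded_linear_scale_vec]]] .
  ultimately show ?thesis
    using borel_measurable_sum[of UNIV "\<lambda>i x. f x $ i *s axis i 1" M] by metis
qed

lemma borel_measurable_dotc [measurable]:
  assumes [measurable]: "f \<in> borel_measurable M" "g \<in> borel_measurable M"
  shows "(\<lambda>x. dotc (f x) (g x)) \<in> borel_measurable M"
proof -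
  have "(\<lambda>x. f x $ i) \<in> borel_measurable M" "(\<lambda>x. g x $ i) \<in> borel_measurable M" for i
    by (rule measurable_compose[OF _ borel_measurable_continuous_onI[OF
            linear_continuous_on[OF bounded_linear_vec_nth]]]; measurable)+
  then show ?thesis
    unfolding dotc_def by (intro borel_measurable_sum borel_measurable_times)
qed

text \<open>Dominated convergence for a series of dyads on a finite measure. The majorant bounds the
  product of the norms of \<open>V m\<close> and \<open>W m y\<close>, because for evanescent modes
  the first factor may grow with m and only the product is summable.\<close>

lemma integral_modal_sum:
  fixes V :: "nat \<Rightarrow> complex^3" and W :: "nat \<Rightarrow> 'a \<Rightarrow> complex^3" and f :: "'a \<Rightarrow> complex^3"
  assumes fin: "finite_measure \<mu>"
    and [measurable]: "\<And>m. W m \<in> borel_measurable \<mu>" "f \<in> borel_measurable \<mu>"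
    and W: "\<And>m y. y \<in> space \<mu> \<Longrightarrow> norm (V m) * norm (W m y) \<le> K m"
    and f: "\<And>y. y \<in> space \<mu> \<Longrightarrow> norm (f y) \<le> B"
    and K: "summable K"
    and G: "\<And>m y. y \<in> space \<mu> \<Longrightarrow> G m y = outer (V m) (W m y)"
  shows "integrable \<mu> (\<lambda>y. (\<Sum>m. G m y) *v f y)" (is ?int)
    and "(LINT y|\<mu>. (\<Sum>m. G m y) *v f y) = (\<Sum>m. (LINT y|\<mu>. dotc (W m y) (f y)) *s V m)" (is ?eq)
proof -
  interpret finite_measure \<mu> by fact
  define F where "F m y = dotc (W m y) (f y) *s V m" for m y
  have nF: "norm (F m y) \<le> 3 * B * K m" if "y \<in> space \<mu>" for m y
  proof -
    have "norm (F m y) \<le> 3 * (norm (W m y) * norm (f y)) * norm (V m)"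
      unfolding F_def by (simp add: mult_right_mono norm_dotc_le)
    also have "\<dots> = 3 * norm (f y) * (norm (V m) * norm (W m y))" by simp
    also have "\<dots> \<le> 3 * B * K m"
      using that W[of y m] f[of y] norm_ge_zero[of "f y"]
      by (intro mult_mono) (auto intro: order_trans[OF _ W] order_trans[OF norm_ge_zero])
    finally show ?thesis .
  qed
  have dot_meas: "(\<lambda>y. dotc (W m y) (f y)) \<in> borel_measurable \<mu>" for m
    by measurable
  have F_meas: "F m \<in> borel_measurable \<mu>" for m
    unfolding F_def
    using measurable_compose[OF dot_meas borel_measurable_continuous_onI[OF
          linear_continuous_on[OF bounded_linear_scale_vec]]] .
  have F_int: "integrable \<mu> (F m)" for m
    using F_meas nF by (intro integrable_const_bound[of _ "3 * B * K m"]) auto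
  have sumK: "summable (\<lambda>m. 3 * B * K m)"
    using K by (intro summable_mult)
  have sum_norm: "summable (\<lambda>m. norm (F m y))" if "y \<in> space \<mu>" for y
    using nF[OF that] by (intro summable_comparison_test'[OF sumK]) auto
  \<comment> \<open>Finiteness of the measure turns the pointwise majorant into a bound on the L1
    norms, as the exchange of sum and integral requires.\<close>
  have sum_int: "summable (\<lambda>m. LINT y|\<mu>. norm (F m y))"
  proof (rule summable_comparison_test')
    show "summable (\<lambda>m. 3 * B * K m * measure \<mu> (space \<mu>))"
      using sumK by (rule summable_mult2)
    fix m :: nat
    have "(LINT y|\<mu>. norm (F m y)) \<le> (LINT y|\<mu>. 3 * B * K m)"
      using F_int nF by (intro integral_mono) auto
    then show "norm (LINT y|\<mu>. norm (F m y)) \<le> 3 * B * K m * measure \<mu> (space \<mu>)"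
      by (simp add: mult_ac)
  qed
  have GF: "(\<Sum>m. G m y) *v f y = (\<Sum>m. F m y)" if y: "y \<in> space \<mu>" for y
  proof -
    have "summable (\<lambda>m. G m y)"
      using W[OF y] by (intro summable_comparison_test'[OF K]) (auto simp: G[OF y] norm_outer)
    from bounded_linear.suminf[OF bounded_linear_mult_vec this] show ?thesis
      by (simp add: G[OF y] outer_mult_vec F_def)
  qed
  \<comment> \<open>The majorant controls \<open>W m\<close> only after division by the norm of
    \<open>V m\<close>; if \<open>V m\<close> vanishes, both sides of \<open>F_eq\<close> are zero
    anyway.\<close>
  have dot_int: "integrable \<mu> (\<lambda>y. dotc (W m y) (f y))" if "V m \<noteq> 0" for m
  proof (rule integrable_const_bound[OF _ dot_meas])
    show "AE y in \<mu>. norm (dotc (W m y) (f y)) \<le> 3 * B * K m / norm (V m)"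
      using nF that by (auto simp: F_def field_simps)
  qed
  have F_eq: "integral\<^sup>L \<mu> (F m) = (LINT y|\<mu>. dotc (W m y) (f y)) *s V m" for m
  proof (cases "V m = 0")
    case False
    then show ?thesis
      unfolding F_def using integral_bounded_linear[OF bounded_linear_scale_vec dot_int] by blast
  qed (simp add: F_def[abs_def])
  have "integrable \<mu> (\<lambda>y. \<Sum>m. F m y)"
    using F_int sum_norm sum_int by (intro integrable_suminf) auto
  then show ?int
    using GF by (simp cong: Bochner_Integration.integrable_cong)
  have "(LINT y|\<mu>. (\<Sum>m. G m y) *v f y) = (LINT y|\<mu>. (\<Sum>m. F m y))"
    using GF by (intro Bochner_Integration.integral_cong) auto
  also have "\<dots> = (\<Sum>m. integral\<^sup>L \<mu> (F m))"
    using F_int sum_norm sum_int by (intro integral_suminf) auto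
  finally show ?eq
    by (simp add: F_eq)
qed

section \<open>Orthogonality of the transverse modes\<close>

text \<open>Gram matrix of the functions cos (i pi s / L) on (0, L); the constant function has twice
  the square norm of the others.\<close>

definition cosint :: "real \<Rightarrow> nat \<Rightarrow> nat \<Rightarrow> real" where
  "cosint L i j = (if i \<noteq> j then 0 else if i = 0 then L else L / 2)"

text \<open>Gram matrix of the functions sin (i pi s / L) on (0, L); index 0 is the zero
  function.\<close>

definition sinint :: "real \<Rightarrow> nat \<Rightarrow> nat \<Rightarrow> real" where
  "sinint L i j = (if i \<noteq> j \<or> i = 0 then 0 else L / 2)"

lemma set_integrable_Ioo_continuous:
  fixes f :: "real \<Rightarrow> real"
  assumes "continuous_on UNIV f"
  shows "set_integrable lborel {0<..<L} f"
proof (rule set_integrable_subset)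
  show "set_integrable lborel {0..L} f"
    using assms by (intro borel_integrable_atLeastAtMost') (rule continuous_on_subset, auto)
qed auto

text \<open>The frequency is an integer because the product formulas produce the difference i - j as
  well as the sum i + j of two indices.\<close>

lemma integral_cos_int:
  fixes l :: int
  assumes "L > 0"
  shows "(LINT s:{0<..<L}|lborel. cos (of_int l * pi * s / L)) = (if l = 0 then L else 0)"
proof -
  define F where "F s = (if l = 0 then s else L / (of_int l * pi) * sin (of_int l * pi * s / L))" for s
  have "(LBINT s=ereal 0..ereal L. cos (of_int l * pi * s / L)) = F L - F 0"
  proof (rule interval_integral_FTC_finite)
    show "continuous_on {min 0 L..max 0 L} (\<lambda>s. cos (of_int l * pi * s / L))"
      using assms by (intro continuous_intros) auto
    fix s
    have "(F has_real_derivative cos (of_int l * pi * s / L)) (at s)"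
      unfolding F_def using assms
      by (cases "l = 0") (auto intro!: derivative_eq_intros simp: field_simps)
    then show "(F has_vector_derivative cos (of_int l * pi * s / L)) (at s within {min 0 L..max 0 L})"
      by (simp add: has_real_derivative_iff_has_vector_derivative has_vector_derivative_at_within)
  qed
  moreover have "F L - F 0 = (if l = 0 then L else 0)"
    using assms sin_integer_2pi[of l] by (auto simp: F_def sin_zero_iff_int2 mult.commute)
  moreover have "(LBINT s=ereal 0..ereal L. cos (of_int l * pi * s / L)) = (LINT s:{0<..<L}|lborel. cos (of_int l * pi * s / L))"
    using assms interval_integral_Ioo[of "ereal 0" "ereal L"] by simp
  ultimately show ?thesis by simp
qed

lemma integral_trig_products:
  assumes "L > 0"
  shows "(LINT s:{0<..<L}|lborel. cos (real i * pi * s / L) * cos (real j * pi * s / L)) = cosint L i j" (is ?C)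
    and "(LINT s:{0<..<L}|lborel. sin (real i * pi * s / L) * sin (real j * pi * s / L)) = sinint L i j" (is ?S)
proof -
  let ?c = "\<lambda>l s. cos (of_int l * pi * s / L)"
  have int: "set_integrable lborel {0<..<L} (\<lambda>s. ?c l s / 2)" for l
    using assms by (intro set_integrable_Ioo_continuous continuous_intros) auto
  have val: "(LINT s:{0<..<L}|lborel. ?c l s / 2) = (if l = 0 then L / 2 else 0)" for l
    using integral_cos_int[OF assms, of l] by simp
  have cc: "cos (real i * pi * s / L) * cos (real j * pi * s / L)
      = ?c (int i - int j) s / 2 + ?c (int i + int j) s / 2"
    and ss: "sin (real i * pi * s / L) * sin (real j * pi * s / L)
      = ?c (int i - int j) s / 2 - ?c (int i + int j) s / 2" for s
    by (simp_all add: cos_times_cos sin_times_sin ring_distribs add_divide_distrib diff_divide_distrib)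
  show ?C
    by (simp only: cc set_integral_add(2)[OF int int] val) (auto simp: cosint_def)
  show ?S
    by (simp only: ss set_integral_diff(2)[OF int int] val) (auto simp: sinint_def)
qed

text \<open>The two Gram matrices differ only in the entry (0, 0). Where they differ, a wavenumber
  factor in front vanishes, so sine integrals can be traded for cosine integrals below.\<close>

lemma sinint_eq_cosint: "i > 0 \<or> j > 0 \<Longrightarrow> sinint L i j = cosint L i j"
  by (auto simp: sinint_def cosint_def)

section \<open>Integrals over the cross-section and the transverse profiles\<close>

context waveguide
begin

lemma sets_cross_section [measurable]: "cross_section \<in> sets borel"
  unfolding cross_section_def by (intro borel_open open_Times) auto

lemma set_integrable_cross_section:
  fixes f :: "real \<times> real \<Rightarrow> real"
  assumes "continuous_on UNIV f"
  shows "set_integrable lborel cross_section f"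
proof (rule set_integrable_subset)
  show "set_integrable lborel ({0..a} \<times> {0..b}) f"
    unfolding set_integrable_def
    by (intro borel_integrable_compact compact_Times) (auto intro: continuous_on_subset[OF assms])
  show "cross_section \<in> sets lborel"
    by simp
qed (auto simp: cross_section_def)

lemma set_integral_cross_section_product:
  fixes f f' :: "real \<Rightarrow> real"
  assumes f: "continuous_on UNIV f" "continuous_on UNIV f'"
  shows "(LINT p:cross_section|lborel. f (fst p) * f' (snd p))
    = (LINT s:{0<..<a}|lborel. f s) * (LINT t:{0<..<b}|lborel. f' t)"
proof -
  have *: "integrable (lborel \<Otimes>\<^sub>M lborel) (\<lambda>p. indicator cross_section p *\<^sub>R (f (fst p) * f' (snd p)))"
    unfolding lborel_prod set_integrable_def[symmetric]
    by (intro set_integrable_cross_section continuous_intros continuous_on_compose2[OF f(1)]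
        continuous_on_compose2[OF f(2)]) auto
  have "(LINT p:cross_section|lborel. f (fst p) * f' (snd p))
    = (LINT s|lborel. LINT t|lborel. indicator cross_section (s, t) *\<^sub>R (f s * f' t))"
    using lborel_pair.integral_fst'[OF *] by (simp add: set_lebesgue_integral_def lborel_prod)
  also have "\<dots> = (LINT s|lborel. LINT t|lborel. (indicator {0<..<a} s *\<^sub>R f s) * (indicator {0<..<b} t *\<^sub>R f' t))"
    by (simp add: cross_section_def indicator_times mult_ac)
  finally show ?thesis
    by (simp add: set_lebesgue_integral_def)
qed

text \<open>The inner product of two tangential profiles has exactly this shape: one separated
  product for each tangential component.\<close>

lemma set_integral_cross_section_products:
  fixes f f' e e' :: "real \<Rightarrow> real"
  assumes "continuous_on UNIV f" "continuous_on UNIV f'" "continuous_on UNIV e" "continuous_on UNIV e'"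
  shows "(LINT p:cross_section|lborel. c * (f (fst p) * f' (snd p)) + d * (e (fst p) * e' (snd p)))
    = c * ((LINT s:{0<..<a}|lborel. f s) * (LINT t:{0<..<b}|lborel. f' t))
    + d * ((LINT s:{0<..<a}|lborel. e s) * (LINT t:{0<..<b}|lborel. e' t))"
proof -
  have "set_integrable lborel cross_section (\<lambda>p. c * (f (fst p) * f' (snd p)))"
    "set_integrable lborel cross_section (\<lambda>p. d * (e (fst p) * e' (snd p)))"
    by (intro set_integrable_cross_section continuous_intros continuous_on_compose2[OF assms(1)]
        continuous_on_compose2[OF assms(2)] continuous_on_compose2[OF assms(3)]
        continuous_on_compose2[OF assms(4)]; simp)+
  from set_integral_add(2)[OF this] show ?thesis
    by (simp add: set_integral_cross_section_product assms)
qed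

text \<open>The normalisation is a definite description, so its value is available only once
  \<open>c\<^sup>2 * I = 1\<close> is known to have exactly one positive solution.\<close>

lemma unit_const_eq:
  assumes "(LINT p:cross_section|lborel. (f (fst p) (snd p))\<^sup>2) = I" "I > 0"
  shows "unit_const f = 1 / sqrt I"
proof -
  have "(LINT p:cross_section|lborel. (c * f (fst p) (snd p))\<^sup>2) = c\<^sup>2 * I" for c
    using assms(1) by (simp add: power_mult_distrib)
  moreover have "c > 0 \<and> c\<^sup>2 * I = 1 \<longleftrightarrow> c = 1 / sqrt I" for c
  proof -
    have "c > 0 \<and> c\<^sup>2 * I = 1 \<longleftrightarrow> c > 0 \<and> c\<^sup>2 = (1 / sqrt I)\<^sup>2"
      using assms(2) by (auto simp: power_divide field_simps)
    also have "\<dots> \<longleftrightarrow> c = 1 / sqrt I"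
      using assms(2) by (auto simp: power2_eq_iff_nonneg)
    finally show ?thesis .
  qed
  ultimately show ?thesis
    unfolding unit_const_def by simp
qed

abbreviation m1 :: "nat \<Rightarrow> nat" where "m1 m \<equiv> fst (mi m)"
abbreviation m2 :: "nat \<Rightarrow> nat" where "m2 m \<equiv> snd (mi m)"
abbreviation n1 :: "nat \<Rightarrow> nat" where "n1 n \<equiv> fst (ni n)"
abbreviation n2 :: "nat \<Rightarrow> nat" where "n2 n \<equiv> snd (ni n)"

text \<open>The profile (d_2 u_m, -d_1 u_m, 0) of the field \<open>M_m\<close>, with the derivatives
  carried out so that it can be integrated and estimated directly.\<close>

definition rot_u :: "nat \<Rightarrow> real \<times> real \<Rightarrow> real^3" where
  "rot_u m p = unit_const (cos_mode m) *\<^sub>R vector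
    [- (real (m2 m) * pi / b * (cos (real (m1 m) * pi * fst p / a) * sin (real (m2 m) * pi * snd p / b))),
     real (m1 m) * pi / a * (sin (real (m1 m) * pi * fst p / a) * cos (real (m2 m) * pi * snd p / b)), 0]"

definition grad_v :: "nat \<Rightarrow> real \<times> real \<Rightarrow> real^3" where
  "grad_v n p = unit_const (sin_mode n) *\<^sub>R vector
    [real (n1 n) * pi / a * (cos (real (n1 n) * pi * fst p / a) * sin (real (n2 n) * pi * snd p / b)),
     real (n2 n) * pi / b * (sin (real (n1 n) * pi * fst p / a) * cos (real (n2 n) * pi * snd p / b)), 0]"

definition axial_v :: "nat \<Rightarrow> real \<times> real \<Rightarrow> real^3" where
  "axial_v n p = vector [0, 0, (mu n)\<^sup>2 * v n (fst p) (snd p)]"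

lemma field_Q_eq: "field_Q n x = (1 / of_real k * exp (\<i> * g n * of_real (x$3))) *s cvec (axial_v n (x$1, x$2))"
  by (simp add: field_Q_def cvec_def vec_eq_iff forall_3 axial_v_def)

lemma lam_sq: "(lam m)\<^sup>2 = (real (m1 m) * pi / a)\<^sup>2 + (real (m2 m) * pi / b)\<^sup>2"
  by (simp add: lam_def)

lemma mu_sq: "(mu n)\<^sup>2 = (real (n1 n) * pi / a)\<^sup>2 + (real (n2 n) * pi / b)\<^sup>2"
  by (simp add: mu_def)

text \<open>Tangential against axial vectors, hence pointwise and even at different points: the Q
  part of a Green term does not see a tangential source.\<close>

lemma axial_v_orth: "grad_v n p \<bullet> axial_v n' q = 0" "rot_u m p \<bullet> axial_v n' q = 0"
  by (simp_all add: grad_v_def rot_u_def axial_v_def inner_vec_def sum_3)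

lemma grad_v_nth [simp]: "grad_v n p $ 3 = 0" and rot_u_nth [simp]: "rot_u m p $ 3 = 0"
  by (simp_all add: grad_v_def rot_u_def)

end

section \<open>Normalisation and L2 orthogonality of the transverse profiles\<close>

locale rectangular_waveguide = waveguide +
  assumes a_pos: "a > 0" and b_pos: "b > 0"
begin

lemma field_M_eq: "field_M m x = exp (\<i> * h m * of_real (x$3)) *s cvec (rot_u m (x$1, x$2))"
proof -
  have "deriv (\<lambda>t. u m (x$1) t) (x$2) = rot_u m (x$1, x$2) $ 1"
    unfolding rot_u_def u_def cos_mode_def
    by (rule DERIV_imp_deriv) (use a_pos b_pos in \<open>auto intro!: derivative_eq_intros\<close>)
  moreover have "deriv (\<lambda>s. u m s (x$2)) (x$1) = - rot_u m (x$1, x$2) $ 2"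
    unfolding rot_u_def u_def cos_mode_def
    by (rule DERIV_imp_deriv) (use a_pos b_pos in \<open>auto intro!: derivative_eq_intros\<close>)
  moreover have "rot_u m (x$1, x$2) $ 3 = 0"
    by (simp add: rot_u_def)
  ultimately show ?thesis
    by (simp add: field_M_def cvec_def vec_eq_iff forall_3)
qed

lemma field_P_eq: "field_P n x = (\<i> * g n / of_real k * exp (\<i> * g n * of_real (x$3))) *s cvec (grad_v n (x$1, x$2))"
proof -
  have "deriv (\<lambda>s. v n s (x$2)) (x$1) = grad_v n (x$1, x$2) $ 1"
    unfolding grad_v_def v_def sin_mode_def
    by (rule DERIV_imp_deriv) (use a_pos b_pos in \<open>auto intro!: derivative_eq_intros\<close>)
  moreover have "deriv (\<lambda>t. v n (x$1) t) (x$2) = grad_v n (x$1, x$2) $ 2"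
    unfolding grad_v_def v_def sin_mode_def
    by (rule DERIV_imp_deriv) (use a_pos b_pos in \<open>auto intro!: derivative_eq_intros\<close>)
  moreover have "grad_v n (x$1, x$2) $ 3 = 0"
    by (simp add: grad_v_def)
  ultimately show ?thesis
    by (simp add: field_P_def cvec_def vec_eq_iff forall_3)
qed

lemmas trig_integrals = integral_trig_products[OF a_pos] integral_trig_products[OF b_pos]

lemma unit_const_cos_mode:
  "unit_const (cos_mode m) = 1 / sqrt (cosint a (m1 m) (m1 m) * cosint b (m2 m) (m2 m))"
proof (rule unit_const_eq)
  have "(\<lambda>p. (cos_mode m (fst p) (snd p))\<^sup>2) =
    (\<lambda>p. (cos (real (m1 m) * pi * fst p / a) * cos (real (m1 m) * pi * fst p / a))
      * (cos (real (m2 m) * pi * snd p / b) * cos (real (m2 m) * pi * snd p / b)))"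
    by (simp add: fun_eq_iff cos_mode_def power2_eq_square)
  then show "(LINT p:cross_section|lborel. (cos_mode m (fst p) (snd p))\<^sup>2)
      = cosint a (m1 m) (m1 m) * cosint b (m2 m) (m2 m)"
    using a_pos b_pos
    by (simp only: trig_integrals, subst set_integral_cross_section_product)
       (auto intro!: continuous_intros simp: trig_integrals)
  show "cosint a (m1 m) (m1 m) * cosint b (m2 m) (m2 m) > 0"
    using a_pos b_pos by (simp add: cosint_def)
qed

lemma unit_const_sin_mode:
  assumes "n1 n > 0" "n2 n > 0"
  shows "unit_const (sin_mode n) = 1 / sqrt (a * b / 4)"
proof (rule unit_const_eq)
  have "(\<lambda>p. (sin_mode n (fst p) (snd p))\<^sup>2) =
    (\<lambda>p. (sin (real (n1 n) * pi * fst p / a) * sin (real (n1 n) * pi * fst p / a))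
      * (sin (real (n2 n) * pi * snd p / b) * sin (real (n2 n) * pi * snd p / b)))"
    by (simp add: fun_eq_iff sin_mode_def power2_eq_square)
  then show "(LINT p:cross_section|lborel. (sin_mode n (fst p) (snd p))\<^sup>2) = a * b / 4"
    using a_pos b_pos assms
    by (simp only:, subst set_integral_cross_section_product)
       (auto intro!: continuous_intros simp: trig_integrals sinint_def)
  show "a * b / 4 > 0"
    using a_pos b_pos by simp
qed

text \<open>Rotation preserves lengths, so the diagonal value is the Dirichlet energy of a unit
  eigenfunction, its eigenvalue \<open>(lam m)\<^sup>2\<close>. The computation reduces both
  components to the common factor \<open>?A * ?A' * (?C1 * ?C2)\<close>, the inner product of u_m
  and u_m'.\<close>

lemma rot_u_orthonormal:
  assumes "inj mi"
  shows "(LINT p:cross_section|lborel. rot_u m p \<bullet> rot_u m' p) = (if m = m' then (lam m)\<^sup>2 else 0)"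
proof -
  let ?A = "unit_const (cos_mode m)" and ?A' = "unit_const (cos_mode m')"
  let ?p = "real (m1 m) * pi / a" and ?q = "real (m2 m) * pi / b"
  let ?p' = "real (m1 m') * pi / a" and ?q' = "real (m2 m') * pi / b"
  let ?C1 = "cosint a (m1 m) (m1 m')" and ?C2 = "cosint b (m2 m) (m2 m')"
  let ?S1 = "sinint a (m1 m) (m1 m')" and ?S2 = "sinint b (m2 m) (m2 m')"
  have "(\<lambda>p. rot_u m p \<bullet> rot_u m' p) = (\<lambda>p.
      (?A * ?A' * ?q * ?q') * ((cos (real (m1 m) * pi * fst p / a) * cos (real (m1 m') * pi * fst p / a))
        * (sin (real (m2 m) * pi * snd p / b) * sin (real (m2 m') * pi * snd p / b)))
    + (?A * ?A' * ?p * ?p') * ((sin (real (m1 m) * pi * fst p / a) * sin (real (m1 m') * pi * fst p / a))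
        * (cos (real (m2 m) * pi * snd p / b) * cos (real (m2 m') * pi * snd p / b))))"
    by (simp add: fun_eq_iff rot_u_def inner_vec_def sum_3 algebra_simps)
  then have "(LINT p:cross_section|lborel. rot_u m p \<bullet> rot_u m' p)
      = (?A * ?A' * ?q * ?q') * (?C1 * ?S2) + (?A * ?A' * ?p * ?p') * (?S1 * ?C2)"
    using a_pos b_pos
    by (simp only:, subst set_integral_cross_section_products)
       (auto intro!: continuous_intros simp: trig_integrals)
  \<comment> \<open>A sine integral can differ from the cosine integral only at index 0, and then
    its prefactor \<open>?q\<close> or \<open>?p\<close> is zero.\<close>
  also have "\<dots> = (?A * ?A' * ?q * ?q') * (?C1 * ?C2) + (?A * ?A' * ?p * ?p') * (?C1 * ?C2)"
    using sinint_eq_cosint[of "m1 m" "m1 m'" a] sinint_eq_cosint[of "m2 m" "m2 m'" b]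
    by (cases "m1 m = 0"; cases "m2 m = 0"; simp)
  also have "\<dots> = (if m = m' then (lam m)\<^sup>2 else 0)"
  proof (cases "m = m'")
    case True
    have "?C1 * ?C2 > 0"
      using True a_pos b_pos by (simp add: cosint_def)
    moreover have "?A * ?A' = 1 / (?C1 * ?C2)"
      using True \<open>?C1 * ?C2 > 0\<close> by (simp add: unit_const_cos_mode)
    ultimately have "?A * ?A' * (?C1 * ?C2) = 1"
      by (metis nonzero_eq_divide_eq less_irrefl)
    moreover have "(?A * ?A' * ?q * ?q') * (?C1 * ?C2) + (?A * ?A' * ?p * ?p') * (?C1 * ?C2)
      = (?A * ?A' * (?C1 * ?C2)) * (?p * ?p' + ?q * ?q')"
      by (simp only: algebra_simps)
    ultimately show ?thesis
      using True by (simp add: lam_sq[unfolded power2_eq_square] power2_eq_square)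
  next
    case False
    then have "mi m \<noteq> mi m'"
      using assms by (simp add: inj_eq)
    then have zero: "?C1 * ?C2 = 0"
      by (auto simp: cosint_def prod_eq_iff)
    show ?thesis
      unfolding zero using False by simp
  qed
  finally show ?thesis .
qed

text \<open>Again the Dirichlet energy of a unit eigenfunction. Injectivity is stated on a set
  \<open>I\<close> since the enumeration \<open>ni\<close> is meaningful only from index 1
  on.\<close>

lemma grad_v_orthonormal:
  assumes "inj_on ni I" "n \<in> I" "n' \<in> I" "n1 n > 0" "n2 n > 0"
  shows "(LINT p:cross_section|lborel. grad_v n p \<bullet> grad_v n' p) = (if n = n' then (mu n)\<^sup>2 else 0)"
proof -
  let ?A = "unit_const (sin_mode n)" and ?A' = "unit_const (sin_mode n')"
  let ?p = "real (n1 n) * pi / a" and ?q = "real (n2 n) * pi / b"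
  let ?p' = "real (n1 n') * pi / a" and ?q' = "real (n2 n') * pi / b"
  let ?C1 = "cosint a (n1 n) (n1 n')" and ?C2 = "cosint b (n2 n) (n2 n')"
  let ?S1 = "sinint a (n1 n) (n1 n')" and ?S2 = "sinint b (n2 n) (n2 n')"
  have "(\<lambda>p. grad_v n p \<bullet> grad_v n' p) = (\<lambda>p.
      (?A * ?A' * ?p * ?p') * ((cos (real (n1 n) * pi * fst p / a) * cos (real (n1 n') * pi * fst p / a))
        * (sin (real (n2 n) * pi * snd p / b) * sin (real (n2 n') * pi * snd p / b)))
    + (?A * ?A' * ?q * ?q') * ((sin (real (n1 n) * pi * fst p / a) * sin (real (n1 n') * pi * fst p / a))
        * (cos (real (n2 n) * pi * snd p / b) * cos (real (n2 n') * pi * snd p / b))))"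
    by (simp add: fun_eq_iff grad_v_def inner_vec_def sum_3 algebra_simps)
  then have "(LINT p:cross_section|lborel. grad_v n p \<bullet> grad_v n' p)
      = (?A * ?A' * ?p * ?p') * (?C1 * ?S2) + (?A * ?A' * ?q * ?q') * (?S1 * ?C2)"
    using a_pos b_pos
    by (simp only:, subst set_integral_cross_section_products)
       (auto intro!: continuous_intros simp: trig_integrals)
  also have "\<dots> = (if n = n' then (mu n)\<^sup>2 else 0)"
  proof (cases "n = n'")
    case True
    have "?A * ?A' = 4 / (a * b)"
      using a_pos b_pos by (simp add: unit_const_sin_mode[OF assms(4,5)] flip: True)
    then have "?A * ?A' * (a * b / 4) = 1"
      using a_pos b_pos by simp
    moreover have "?C1 * ?S2 = a * b / 4" "?S1 * ?C2 = a * b / 4"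
      using True assms by (auto simp: cosint_def sinint_def)
    then have "(?A * ?A' * ?p * ?p') * (?C1 * ?S2) + (?A * ?A' * ?q * ?q') * (?S1 * ?C2)
      = (?A * ?A' * (a * b / 4)) * (?p * ?p' + ?q * ?q')"
      by (simp only: algebra_simps)
    ultimately show ?thesis
      using True by (simp add: mu_sq[unfolded power2_eq_square] power2_eq_square)
  next
    case False
    then have "ni n \<noteq> ni n'"
      using assms by (auto dest: inj_onD)
    then have zero: "?C1 * ?S2 = 0" "?S1 * ?C2 = 0"
      by (auto simp: cosint_def sinint_def prod_eq_iff)
    show ?thesis
      unfolding zero using False by simp
  qed
  finally show ?thesis .
qed

text \<open>After the exchange of sine for cosine integrals the value is a multiple of
  \<open>?C1 * ?C2\<close> times the determinant \<open>?p * ?q' - ?q * ?p'\<close>. The first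
  factor vanishes unless the two index pairs agree, and then the determinant is zero.\<close>

lemma rot_u_grad_v_orthogonal:
  assumes "n1 n > 0" "n2 n > 0"
  shows "(LINT p:cross_section|lborel. rot_u m p \<bullet> grad_v n p) = 0"
proof -
  let ?A = "unit_const (cos_mode m)" and ?A' = "unit_const (sin_mode n)"
  let ?p = "real (m1 m) * pi / a" and ?q = "real (m2 m) * pi / b"
  let ?p' = "real (n1 n) * pi / a" and ?q' = "real (n2 n) * pi / b"
  let ?C1 = "cosint a (m1 m) (n1 n)" and ?C2 = "cosint b (m2 m) (n2 n)"
  let ?S1 = "sinint a (m1 m) (n1 n)" and ?S2 = "sinint b (m2 m) (n2 n)"
  have "(\<lambda>p. rot_u m p \<bullet> grad_v n p) = (\<lambda>p.
      (- ?A * ?A' * ?q * ?p') * ((cos (real (m1 m) * pi * fst p / a) * cos (real (n1 n) * pi * fst p / a))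
        * (sin (real (m2 m) * pi * snd p / b) * sin (real (n2 n) * pi * snd p / b)))
    + (?A * ?A' * ?p * ?q') * ((sin (real (m1 m) * pi * fst p / a) * sin (real (n1 n) * pi * fst p / a))
        * (cos (real (m2 m) * pi * snd p / b) * cos (real (n2 n) * pi * snd p / b))))"
    by (simp add: fun_eq_iff grad_v_def rot_u_def inner_vec_def sum_3 algebra_simps)
  then have "(LINT p:cross_section|lborel. rot_u m p \<bullet> grad_v n p)
      = (- ?A * ?A' * ?q * ?p') * (?C1 * ?S2) + (?A * ?A' * ?p * ?q') * (?S1 * ?C2)"
    using a_pos b_pos
    by (simp only:, subst set_integral_cross_section_products)
       (auto intro!: continuous_intros simp: trig_integrals)
  also have "\<dots> = ?A * ?A' * (?C1 * ?C2) * (?p * ?q' - ?q * ?p')"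
    using sinint_eq_cosint[of "m1 m" "n1 n" a] sinint_eq_cosint[of "m2 m" "n2 n" b] assms
    by (simp add: algebra_simps)
  also have "\<dots> = 0"
    by (auto simp: cosint_def mult_ac)
  finally show ?thesis .
qed

end

section \<open>Propagating and evanescent modes\<close>

lemma cvec_nth [simp]: "cvec w $ i = of_real (w $ i)"
  by (simp add: cvec_def)

lemma cnj_vec_scaled_cvec: "cnj_vec (c *s cvec w) = cnj c *s cvec w"
  by (simp add: cnj_vec_def vec_eq_iff)

lemma mirror_nth [simp]: "mirror x $ 1 = x $ 1" "mirror x $ 2 = x $ 2" "mirror x $ 3 = - x $ 3"
  by (simp_all add: mirror_def)

lemma mult_vec_axis_nth: "(A *v axis j 1) $ i = A $ i $ j" for A :: "complex^3^3"
  by (simp add: matrix_vector_mult_def axis_def if_distrib cong: if_cong)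

lemma borel_measurable_scaled_cvec:
  assumes "\<And>i. (\<lambda>p. R p $ i) \<in> borel_measurable borel"
    and [measurable]: "\<phi> \<in> \<mu> \<rightarrow>\<^sub>M borel"
  shows "(\<lambda>y. c *s cvec (R (\<phi> y))) \<in> borel_measurable \<mu>"
proof (rule borel_measurable_vec3)
  fix i
  have [measurable]: "(\<lambda>y. R (\<phi> y) $ i) \<in> borel_measurable \<mu>"
    using assms by (rule measurable_compose[rotated])
  show "(\<lambda>y. (c *s cvec (R (\<phi> y))) $ i) \<in> borel_measurable \<mu>"
    by simp
qed

text \<open>Covers \<open>rot_u\<close> and \<open>grad_v\<close> at once: both have trigonometric
  products bounded by 1, weighted by the two components of the wave vector.\<close>

lemma norm_tangential_le:
  fixes c1 s1 c2 s2 p q A B l :: real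
  assumes "\<bar>c1\<bar> \<le> 1" "\<bar>s1\<bar> \<le> 1" "\<bar>c2\<bar> \<le> 1" "\<bar>s2\<bar> \<le> 1" "0 \<le> A" "A \<le> B" "l\<^sup>2 = p\<^sup>2 + q\<^sup>2" "l \<ge> 0"
  shows "norm (A *\<^sub>R (vector [p * (c1 * c2), q * (s1 * s2), 0] :: real^3)) \<le> B * l"
proof -
  have unit: "(x * y)\<^sup>2 \<le> 1" if "\<bar>x\<bar> \<le> 1" "\<bar>y\<bar> \<le> 1" for x y :: real
    using that by (simp add: abs_square_le_1 abs_mult mult_le_one)
  have "norm (vector [p * (c1 * c2), q * (s1 * s2), 0] :: real^3) = sqrt (p\<^sup>2 * (c1 * c2)\<^sup>2 + q\<^sup>2 * (s1 * s2)\<^sup>2)"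
    by (simp add: norm_vec_def L2_set_def sum_3 power_mult_distrib)
  also have "\<dots> \<le> sqrt (p\<^sup>2 * 1 + q\<^sup>2 * 1)"
    using assms by (intro real_sqrt_le_mono add_mono mult_left_mono unit) auto
  also have "\<dots> = l"
    using assms(7,8) by (simp flip: assms(7))
  finally show ?thesis
    using assms by (auto intro!: mult_mono)
qed

lemma norm_exp_evanescent:
  assumes "c = \<i> * of_real \<eta>"
  shows "norm (exp (\<i> * c * of_real t)) = exp (- \<eta> * t)" "norm (exp (- (\<i> * c * of_real t))) = exp (\<eta> * t)"
  using assms by simp_all

section \<open>The surface measure on the slice\<close>

context waveguide
begin

definition slice_point :: "real \<Rightarrow> real \<times> real \<Rightarrow> real^3" where
  "slice_point r s = vector [fst s, snd s, r]"

lemma slice_point_nth [simp]: "slice_point r s $ 1 = fst s" "slice_point r s $ 2 = snd s" "slice_point r s $ 3 = r"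
  by (simp_all add: slice_point_def)

lemma measurable_slice_point [measurable]:
  "slice_point r \<in> restrict_space lborel cross_section \<rightarrow>\<^sub>M restrict_space borel (slice r)"
proof (rule measurable_restrict_space2)
  have "slice_point r \<in> borel_measurable borel"
    unfolding slice_point_def
    by (rule borel_measurable_continuous_onI, subst continuous_on_componentwise)
       (auto simp: Basis_vec_def inner_axis forall_3 intro!: continuous_intros)
  then show "slice_point r \<in> restrict_space lborel cross_section \<rightarrow>\<^sub>M borel"
    by (intro measurable_restrict_space1) simp
qed (auto simp: slice_def space_restrict_space)

lemma slice_measure_eq: "slice_measure r
    = distr (restrict_space lborel cross_section) (restrict_space borel (slice r)) (slice_point r)"
  by (simp add: slice_measure_def slice_point_def[abs_def])

lemma space_slice_measure [simp]: "space (slice_measure r) = slice r"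
  by (simp add: slice_measure_eq space_restrict_space)

lemma finite_slice_measure: "finite_measure (slice_measure r)"
proof -
  have "emeasure lborel cross_section < \<infinity>"
    by (intro emeasure_bounded_finite)
       (auto simp: cross_section_def intro: bounded_Times)
  then have "finite_measure (restrict_space lborel cross_section)"
    by (intro finite_measureI) (simp add: emeasure_restrict_space space_restrict_space)
  then show ?thesis
    unfolding slice_measure_eq by (rule finite_measure.finite_measure_distr) measurable
qed

lemma borel_measurable_slice_measure:
  "f \<in> borel_measurable borel \<Longrightarrow> f \<in> borel_measurable (slice_measure r)"
  unfolding slice_measure_eq measurable_distr_eq1 by (rule measurable_restrict_space1)

lemma integral_slice_measure:
  fixes f :: "real^3 \<Rightarrow> 'b::{banach, second_countable_topology}"
  assumes "f \<in> borel_measurable (slice_measure r)"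
  shows "(LINT y|slice_measure r. f y) = (LINT s:cross_section|lborel. f (slice_point r s))"
proof -
  have "(LINT y|slice_measure r. f y) = (LINT s|restrict_space lborel cross_section. f (slice_point r s))"
    unfolding slice_measure_eq using assms
    by (intro integral_distr) (auto simp: slice_measure_eq)
  also have "\<dots> = (LINT s:cross_section|lborel. f (slice_point r s))"
    by (simp add: integral_restrict_space set_lebesgue_integral_def)
  finally show ?thesis .
qed

text \<open>Moves complex amplitudes out of the integral, leaving the real orthogonality integrals
  of the profiles.\<close>

lemma set_integral_cross_section_sum:
  fixes F :: "'i \<Rightarrow> real \<times> real \<Rightarrow> real"
  assumes "finite I" "\<And>i. i \<in> I \<Longrightarrow> continuous_on UNIV (F i)"
  shows "set_integrable lborel cross_section (\<lambda>p. \<Sum>i\<in>I. c i * complex_of_real (F i p))"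
    and "(LINT p:cross_section|lborel. (\<Sum>i\<in>I. c i * complex_of_real (F i p)))
      = (\<Sum>i\<in>I. c i * of_real (LINT p:cross_section|lborel. F i p))"
proof -
  have int: "set_integrable lborel cross_section (\<lambda>p. c i * complex_of_real (F i p))" if "i \<in> I" for i
    using integrable_of_real[OF set_integrable_cross_section[OF assms(2)[OF that], unfolded set_integrable_def], where 'a = complex]
    by (intro set_integrable_mult_right) (simp add: set_integrable_def scaleR_conv_of_real)
  then show "set_integrable lborel cross_section (\<lambda>p. \<Sum>i\<in>I. c i * complex_of_real (F i p))"
    unfolding set_integrable_def by (simp add: scaleR_sum_right)
  show "(LINT p:cross_section|lborel. (\<Sum>i\<in>I. c i * complex_of_real (F i p)))
      = (\<Sum>i\<in>I. c i * of_real (LINT p:cross_section|lborel. F i p))"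
  proof -
    have "(LINT p:cross_section|lborel. (\<Sum>i\<in>I. c i * complex_of_real (F i p)))
        = (\<Sum>i\<in>I. LINT p:cross_section|lborel. c i * complex_of_real (F i p))"
      unfolding set_lebesgue_integral_def scaleR_sum_right
      using int by (intro Bochner_Integration.integral_sum) (simp add: set_integrable_def)
    then show ?thesis
      by (simp add: set_integral_complex_of_real)
  qed
qed

end

section \<open>Continuity, measurability and size of the profiles\<close>

context rectangular_waveguide
begin

lemma continuous_profiles:
  "continuous_on UNIV (\<lambda>p. rot_u m p $ i)"
  "continuous_on UNIV (\<lambda>p. grad_v n p $ i)"
  "continuous_on UNIV (\<lambda>p. axial_v n p $ i)"
  using exhaust_3[of i]
  by (elim disjE; simp add: rot_u_def grad_v_def axial_v_def v_def sin_mode_def;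
      intro continuous_intros; use a_pos b_pos in simp)+

lemma continuous_inner_profiles:
  "continuous_on UNIV (\<lambda>p. rot_u m p \<bullet> rot_u m' p)"
  "continuous_on UNIV (\<lambda>p. rot_u m p \<bullet> grad_v n p)"
  "continuous_on UNIV (\<lambda>p. grad_v n p \<bullet> rot_u m p)"
  "continuous_on UNIV (\<lambda>p. grad_v n p \<bullet> grad_v n' p)"
  unfolding inner_vec_def by (auto intro!: continuous_intros continuous_profiles)

lemma borel_measurable_profiles:
  "(\<lambda>y. c *s cvec (rot_u m (y$1, y$2))) \<in> borel_measurable (slice_measure r)"
  "(\<lambda>y. c *s cvec (grad_v n (y$1, y$2))) \<in> borel_measurable (slice_measure r)"
  "(\<lambda>y. c *s cvec (axial_v n (y$1, y$2))) \<in> borel_measurable (slice_measure r)"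
  by (intro borel_measurable_slice_measure borel_measurable_scaled_cvec
      borel_measurable_continuous_onI[OF continuous_profiles(1)]
      borel_measurable_continuous_onI[OF continuous_profiles(2)]
      borel_measurable_continuous_onI[OF continuous_profiles(3)]
      borel_measurable_continuous_onI continuous_intros)+

text \<open>The normalisation constant 2 / sqrt (a b) of a mode with two positive indices. A zero
  index of a cosine mode doubles a factor of its square norm and makes the constant smaller.\<close>

definition unit_bound :: real where "unit_bound = 1 / sqrt (a * b / 4)"

lemma unit_bound_pos: "unit_bound > 0"
  using a_pos b_pos by (simp add: unit_bound_def)

lemma unit_const_cos_mode_bound: "0 \<le> unit_const (cos_mode m)" "unit_const (cos_mode m) \<le> unit_bound"
proof -
  have "a / 2 * (b / 2) \<le> cosint a (m1 m) (m1 m) * cosint b (m2 m) (m2 m)"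
    using a_pos b_pos by (intro mult_mono) (auto simp: cosint_def)
  then show "0 \<le> unit_const (cos_mode m)" "unit_const (cos_mode m) \<le> unit_bound"
    using a_pos b_pos unfolding unit_const_cos_mode unit_bound_def
    by (auto intro!: frac_le simp: cosint_def)
qed

lemma norm_rot_u_le: "norm (rot_u m p) \<le> unit_bound * lam m"
proof -
  have "(lam m)\<^sup>2 = (- (real (m2 m) * pi / b))\<^sup>2 + (real (m1 m) * pi / a)\<^sup>2" "lam m \<ge> 0"
    by (simp_all add: lam_def)
  from norm_tangential_le[OF _ _ _ _ unit_const_cos_mode_bound this]
  show ?thesis
    unfolding rot_u_def minus_mult_left by (metis abs_cos_le_one abs_sin_le_one)
qed

lemma norm_grad_v_le:
  assumes "n1 n > 0" "n2 n > 0"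
  shows "norm (grad_v n p) \<le> unit_bound * mu n"
proof -
  have "mu n \<ge> 0" "0 \<le> unit_const (sin_mode n)" "unit_const (sin_mode n) \<le> unit_bound"
    using unit_bound_pos by (simp_all add: mu_def unit_const_sin_mode[OF assms] flip: unit_bound_def)
  from norm_tangential_le[OF _ _ _ _ this(2,3) mu_sq this(1)]
  show ?thesis
    unfolding grad_v_def by (metis abs_cos_le_one abs_sin_le_one)
qed

lemma norm_axial_v_le:
  assumes "n1 n > 0" "n2 n > 0"
  shows "norm (axial_v n p) \<le> unit_bound * (mu n)\<^sup>2"
proof -
  have "\<bar>sin_mode n (fst p) (snd p)\<bar> \<le> 1"
    by (simp add: sin_mode_def abs_mult mult_le_one)
  then have "\<bar>v n (fst p) (snd p)\<bar> \<le> unit_bound"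
    using unit_bound_pos
    by (simp add: v_def unit_const_sin_mode[OF assms] abs_mult mult_left_le flip: unit_bound_def)
  then have "(mu n)\<^sup>2 * \<bar>v n (fst p) (snd p)\<bar> \<le> (mu n)\<^sup>2 * unit_bound"
    by (intro mult_left_mono) auto
  then show ?thesis
    by (simp add: axial_v_def norm_vec_def L2_set_def sum_3 abs_mult mult_ac)
qed

end

text \<open>The second family is enumerated from 1, so \<open>mu 0\<close> is no wavenumber, and N =
  0 has to be allowed as the case without propagating modes; in the first family 0 is a genuine
  index.\<close>

locale waveguide_modes = rectangular_waveguide +
  fixes M N :: nat
  assumes k_pos: "k > 0"
    and bij_mi: "bij mi" and mono_lam: "mono lam"
    and bij_ni: "bij_betw ni {1..} ({1..} \<times> {1..})" and mono_mu: "mono_on {1..} mu"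
    and lam_M: "lam M < k" "k < lam (Suc M)"
    and mu_N: "N = 0 \<or> mu N < k" "k < mu (Suc N)"
begin

lemma lam_nonneg: "lam m \<ge> 0" and mu_nonneg: "mu n \<ge> 0"
  by (simp_all add: lam_def mu_def)

text \<open>Only the pair (0, 0) has wavenumber zero, and monotonicity places it at index 0. The
  coefficients \<open>coeff_c\<close> divide by \<open>(lam m)\<^sup>2\<close>, which is why the
  series start at 1.\<close>

lemma lam_pos:
  assumes "m \<ge> 1"
  shows "lam m > 0"
proof -
  have lam_0_iff: "lam i = 0 \<longleftrightarrow> mi i = (0, 0)" for i
    using a_pos b_pos by (auto simp: lam_def prod_eq_iff add_nonneg_eq_0_iff)
  obtain i where "mi i = (0, 0)"
    using bij_mi by (metis bij_pointE)
  then have "mi 0 = (0, 0)"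
    using monoD[OF mono_lam, of 0 i] lam_nonneg[of 0] by (simp flip: lam_0_iff)
  then have "mi m \<noteq> (0, 0)"
    using assms bij_mi by (metis bij_is_inj injD not_one_le_zero)
  then show ?thesis
    using lam_nonneg[of m] lam_0_iff[of m] by simp
qed

lemma n_pos:
  assumes "n \<ge> 1"
  shows "n1 n > 0" "n2 n > 0"
proof -
  have "ni n \<in> {1..} \<times> {1..}"
    using assms bij_ni by (auto simp: bij_betw_def)
  then show "n1 n > 0" "n2 n > 0"
    by (auto simp: mem_Times_iff)
qed

lemma mu_pos: "n \<ge> 1 \<Longrightarrow> mu n > 0"
  using n_pos[of n] a_pos b_pos by (simp add: mu_def add_pos_pos)

lemma csqrt_evanescent:
  assumes "l > k"
  shows "csqrt (complex_of_real (k\<^sup>2 - l\<^sup>2)) = \<i> * of_real (sqrt (l\<^sup>2 - k\<^sup>2))"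
proof -
  have "k\<^sup>2 \<le> l\<^sup>2"
    using assms k_pos by (intro power_mono) auto
  then show ?thesis
    by (simp add: csqrt_of_real_nonpos)
qed

lemma h_propagating:
  assumes "m \<le> M"
  shows "h m = of_real (sqrt (k\<^sup>2 - (lam m)\<^sup>2))" "sqrt (k\<^sup>2 - (lam m)\<^sup>2) > 0"
proof -
  have "lam m < k"
    using assms lam_M(1) monoD[OF mono_lam assms] by simp
  then have "(lam m)\<^sup>2 < k\<^sup>2"
    using lam_nonneg[of m] by (intro power_strict_mono) auto
  then show "h m = of_real (sqrt (k\<^sup>2 - (lam m)\<^sup>2))" "sqrt (k\<^sup>2 - (lam m)\<^sup>2) > 0"
    by (simp_all add: h_def csqrt_of_real_nonneg)
qed

lemma g_propagating:
  assumes "1 \<le> n" "n \<le> N"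
  shows "g n = of_real (sqrt (k\<^sup>2 - (mu n)\<^sup>2))" "sqrt (k\<^sup>2 - (mu n)\<^sup>2) > 0"
proof -
  have "mu n < k"
    using assms mu_N(1) mono_onD[OF mono_mu, of n N] by simp
  then have "(mu n)\<^sup>2 < k\<^sup>2"
    using mu_nonneg[of n] by (intro power_strict_mono) auto
  then show "g n = of_real (sqrt (k\<^sup>2 - (mu n)\<^sup>2))" "sqrt (k\<^sup>2 - (mu n)\<^sup>2) > 0"
    by (simp_all add: g_def csqrt_of_real_nonneg)
qed

lemma sqrt_diff_squares_ge:
  assumes "l > k"
  shows "sqrt (l\<^sup>2 - k\<^sup>2) \<ge> l - k" "sqrt (l\<^sup>2 - k\<^sup>2) \<le> l"
proof -
  have "(l - k)\<^sup>2 \<le> l\<^sup>2 - k\<^sup>2"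
    using mult_left_mono[of k l k] assms k_pos by (simp add: power2_eq_square algebra_simps)
  then show "sqrt (l\<^sup>2 - k\<^sup>2) \<ge> l - k"
    by (rule real_le_rsqrt)
  show "sqrt (l\<^sup>2 - k\<^sup>2) \<le> l"
    using assms k_pos by (intro real_le_lsqrt) auto
qed

text \<open>Two lower bounds with different roles: the one uniform in m controls the factor
  1/\<eta>, the one growing with \<open>lam m\<close> yields the exponential decay.\<close>

lemma h_evanescent:
  assumes "m > M"
  obtains \<eta> where "h m = \<i> * of_real \<eta>" "\<eta> \<ge> lam (Suc M) - k" "\<eta> \<ge> lam m - k" "\<eta> > 0"
proof (rule that)
  have le: "lam (Suc M) \<le> lam m"
    using assms by (intro monoD[OF mono_lam]) auto
  then have "lam m > k"
    using lam_M by simp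
  from sqrt_diff_squares_ge(1)[OF this] le lam_M
  show "sqrt ((lam m)\<^sup>2 - k\<^sup>2) \<ge> lam (Suc M) - k" "sqrt ((lam m)\<^sup>2 - k\<^sup>2) \<ge> lam m - k"
    "sqrt ((lam m)\<^sup>2 - k\<^sup>2) > 0"
    by linarith+
  show "h m = \<i> * of_real (sqrt ((lam m)\<^sup>2 - k\<^sup>2))"
    unfolding h_def using \<open>lam m > k\<close> by (rule csqrt_evanescent)
qed

text \<open>The additional upper bound on \<eta> controls the amplitude of \<open>P_n\<close>, which
  contains the factor \<open>g n\<close>.\<close>

lemma g_evanescent:
  assumes "n > N"
  obtains \<eta> where "g n = \<i> * of_real \<eta>" "\<eta> \<ge> mu (Suc N) - k" "\<eta> \<ge> mu n - k" "\<eta> > 0" "\<eta> \<le> mu n"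
proof (rule that)
  have le: "mu (Suc N) \<le> mu n"
    using assms by (intro mono_onD[OF mono_mu]) auto
  then have "mu n > k"
    using mu_N by simp
  from sqrt_diff_squares_ge[OF this] le mu_N
  show "sqrt ((mu n)\<^sup>2 - k\<^sup>2) \<ge> mu (Suc N) - k" "sqrt ((mu n)\<^sup>2 - k\<^sup>2) \<ge> mu n - k"
    "sqrt ((mu n)\<^sup>2 - k\<^sup>2) > 0" "sqrt ((mu n)\<^sup>2 - k\<^sup>2) \<le> mu n"
    by linarith+
  show "g n = \<i> * of_real (sqrt ((mu n)\<^sup>2 - k\<^sup>2))"
    unfolding g_def using \<open>mu n > k\<close> by (rule csqrt_evanescent)
qed

lemma summable_lam: "d > 0 \<Longrightarrow> summable (\<lambda>m. exp (- d * lam (Suc m)))"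
  using summable_exp_wavenumbers[OF inj_compose[OF bij_is_inj[OF bij_mi] inj_Suc] a_pos b_pos]
  by (simp add: lam_def)

lemma summable_mu: "d > 0 \<Longrightarrow> summable (\<lambda>n. exp (- d * mu (Suc n)))"
  using summable_exp_wavenumbers[OF comp_inj_on[OF inj_Suc inj_on_subset[OF bij_betw_imp_inj_on[OF bij_ni]]] a_pos b_pos]
  by (auto simp: mu_def)

section \<open>Factorisation of the Green terms on the slice and summable majorants\<close>

definition V_M :: "real^3 \<Rightarrow> nat \<Rightarrow> complex^3" where
  "V_M x m = coeff_c m *s (field_M m x - field_M m (mirror x))"

text \<open>Equals the field \<open>M_m\<close> at the mirror image of y when y lies on the slice;
  freezing y_3 at r leaves a constant times a transverse profile.\<close>

definition W_M :: "real \<Rightarrow> nat \<Rightarrow> real^3 \<Rightarrow> complex^3" where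
  "W_M r m y = exp (- (\<i> * h m * of_real r)) *s cvec (rot_u m (y$1, y$2))"

text \<open>The incident field together with its reflection at the end wall x_3 = 0, where the
  tangential part cancels.\<close>

definition standing_PQ :: "nat \<Rightarrow> real^3 \<Rightarrow> complex^3" where
  "standing_PQ n x = (field_P n x - field_P n (mirror x)) + (field_Q n x + field_Q n (mirror x))"

definition V_PQ :: "real^3 \<Rightarrow> nat \<Rightarrow> complex^3" where
  "V_PQ x n = coeff_d n *s standing_PQ n x"

definition W_PQ :: "real \<Rightarrow> nat \<Rightarrow> real^3 \<Rightarrow> complex^3" where
  "W_PQ r n y = (\<i> * g n / of_real k * exp (- (\<i> * g n * of_real r))) *s cvec (grad_v n (y$1, y$2))
     - (1 / of_real k * exp (- (\<i> * g n * of_real r))) *s cvec (axial_v n (y$1, y$2))"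

lemma green_term_M_slice:
  assumes "y \<in> slice r" "r < x$3"
  shows "green_term_M m x y = outer (V_M x m) (W_M r m y)"
  using assms by (simp add: green_term_M_def V_M_def W_M_def slice_def field_M_eq)

lemma green_term_PQ_slice:
  assumes "y \<in> slice r" "r < x$3"
  shows "green_term_PQ n x y = outer (V_PQ x n) (W_PQ r n y)"
  using assms by (simp add: green_term_PQ_def V_PQ_def W_PQ_def standing_PQ_def slice_def field_P_eq field_Q_eq)

lemma measurable_W: "W_M r m \<in> borel_measurable (slice_measure r)" "W_PQ r n \<in> borel_measurable (slice_measure r)"
  unfolding W_M_def[abs_def] W_PQ_def[abs_def]
  by (intro borel_measurable_diff borel_measurable_profiles)+

lemma norm_field_M_le: "norm (field_M m x) \<le> norm (exp (\<i> * h m * of_real (x$3))) * (unit_bound * lam m)"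
  unfolding field_M_eq by (simp add: mult_left_mono norm_rot_u_le)

lemma norm_field_PQ_le:
  assumes "n \<ge> 1"
  shows "norm (field_P n x) \<le> norm (exp (\<i> * g n * of_real (x$3))) * (norm (g n) / k * (unit_bound * mu n))"
    and "norm (field_Q n x) \<le> norm (exp (\<i> * g n * of_real (x$3))) * (unit_bound * (mu n)\<^sup>2 / k)"
proof -
  have "norm (field_P n x) = norm (exp (\<i> * g n * of_real (x$3))) * (norm (g n) / k * norm (grad_v n (x$1, x$2)))"
    using k_pos by (simp add: field_P_eq norm_mult norm_divide)
  also have "\<dots> \<le> norm (exp (\<i> * g n * of_real (x$3))) * (norm (g n) / k * (unit_bound * mu n))"
    using k_pos by (intro mult_left_mono norm_grad_v_le n_pos assms) auto
  finally show "norm (field_P n x) \<le> norm (exp (\<i> * g n * of_real (x$3))) * (norm (g n) / k * (unit_bound * mu n))" .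
  have "norm (field_Q n x) = norm (exp (\<i> * g n * of_real (x$3))) * (norm (axial_v n (x$1, x$2)) / k)"
    using k_pos by (simp add: field_Q_eq norm_mult norm_divide)
  also have "\<dots> \<le> norm (exp (\<i> * g n * of_real (x$3))) * (unit_bound * (mu n)\<^sup>2 / k)"
    using k_pos by (intro mult_left_mono divide_right_mono norm_axial_v_le n_pos assms) auto
  finally show "norm (field_Q n x) \<le> norm (exp (\<i> * g n * of_real (x$3))) * (unit_bound * (mu n)\<^sup>2 / k)" .
qed

text \<open>Retains the exact norm of \<open>V_M\<close>, so that it bounds propagating and
  evanescent terms alike; explicit estimates are made only on the evanescent tail.\<close>

definition K_M :: "real^3 \<Rightarrow> real \<Rightarrow> nat \<Rightarrow> real" where
  "K_M x r m = norm (V_M x m) * (norm (exp (- (\<i> * h m * of_real r))) * (unit_bound * lam m))"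

definition K_PQ :: "real^3 \<Rightarrow> real \<Rightarrow> nat \<Rightarrow> real" where
  "K_PQ x r n = norm (V_PQ x n) * (norm (exp (- (\<i> * g n * of_real r)))
     * (norm (g n) / k * (unit_bound * mu n) + unit_bound * (mu n)\<^sup>2 / k))"

lemma V_W_M_le: "norm (V_M x m) * norm (W_M r m y) \<le> K_M x r m"
  unfolding K_M_def W_M_def by (simp add: mult_left_mono norm_rot_u_le)

lemma V_W_PQ_le:
  assumes "n \<ge> 1"
  shows "norm (V_PQ x n) * norm (W_PQ r n y) \<le> K_PQ x r n"
proof -
  let ?e = "norm (exp (- (\<i> * g n * of_real r)))"
  have "norm (W_PQ r n y) \<le> ?e * (norm (g n) / k * norm (grad_v n (y$1, y$2))) + ?e * (norm (axial_v n (y$1, y$2)) / k)"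
    unfolding W_PQ_def using k_pos
    by (intro order_trans[OF norm_triangle_ineq4]) (simp add: norm_mult norm_divide mult_ac)
  also have "\<dots> \<le> ?e * (norm (g n) / k * (unit_bound * mu n)) + ?e * (unit_bound * (mu n)\<^sup>2 / k)"
    using k_pos
    by (intro add_mono mult_left_mono divide_right_mono norm_axial_v_le norm_grad_v_le n_pos assms) auto
  finally show ?thesis
    unfolding K_PQ_def by (intro mult_left_mono) (simp_all add: distrib_left)
qed

text \<open>The growth in the observation height t is outweighed by the decay in r, leaving exp
  (-\<eta> (t - r)); replacing \<eta> by l - k costs the constant exp ((t - r) k).\<close>

lemma exp_decay_le:
  assumes "\<eta> \<ge> l - k" "r < t"
  shows "exp (- \<eta> * t) * exp (\<eta> * r) \<le> exp ((t - r) * k) * exp (- (t - r) * l)"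
proof -
  have "(t - r) * (l - k) \<le> (t - r) * \<eta>"
    using assms by (intro mult_left_mono) auto
  then have "- \<eta> * t + \<eta> * r \<le> (t - r) * k + - (t - r) * l"
    by (simp add: algebra_simps)
  then show ?thesis
    unfolding exp_add[symmetric] by simp
qed

text \<open>The powers of lambda cancel: the coefficient contributes 1 / lambda^2 and the two
  profiles one factor lambda each. What remains is a bounded constant times a pure
  exponential.\<close>

lemma summable_K_M:
  assumes "r < x$3" "x$3 < 0"
  shows "summable (\<lambda>m. K_M x r (Suc m))"
proof (rule summable_comparison_test')
  let ?C = "unit_bound\<^sup>2 / (lam (Suc M) - k) * exp ((x$3 - r) * k)"
  show "summable (\<lambda>m. ?C * exp (- (x$3 - r) * lam (Suc m)))"
    using assms summable_lam[of "x$3 - r"] by (intro summable_mult) auto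
  \<comment> \<open>The series is shifted by one, so this is exactly the evanescent range
    \<open>Suc m' > M\<close>.\<close>
  fix m' assume "m' \<ge> M"
  define m where "m = Suc m'"
  have m: "m > M" "m \<ge> 1"
    using \<open>m' \<ge> M\<close> by (auto simp: m_def)
  obtain \<eta> where \<eta>: "h m = \<i> * of_real \<eta>" "\<eta> \<ge> lam (Suc M) - k" "\<eta> \<ge> lam m - k" "\<eta> > 0"
    using h_evanescent[OF m(1)] .
  let ?l = "lam m" and ?B = "unit_bound"
  have l: "?l > 0" using lam_pos m by simp
  have "norm (field_M m x - field_M m (mirror x)) \<le> exp (- \<eta> * x$3) * (?B * ?l) + exp (- \<eta> * x$3) * (?B * ?l)"
  proof (rule order_trans[OF norm_triangle_ineq4 add_mono])
    show "norm (field_M m x) \<le> exp (- \<eta> * x$3) * (?B * ?l)"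
      using norm_field_M_le[of m x] unfolding norm_exp_evanescent[OF \<eta>(1)] .
    have "norm (field_M m (mirror x)) \<le> exp (\<eta> * x$3) * (?B * ?l)"
      using norm_field_M_le[of m "mirror x"] unfolding norm_exp_evanescent[OF \<eta>(1)] by simp
    \<comment> \<open>As x_3 < 0, the exponential at the mirror point is at most 1 and the one at x
      at least 1.\<close>
    also have "\<dots> \<le> exp (- \<eta> * x$3) * (?B * ?l)"
      using assms \<eta>(4) l unit_bound_pos by (intro mult_right_mono) (auto simp: mult_nonneg_nonpos intro: order_trans[of _ 0])
    finally show "norm (field_M m (mirror x)) \<le> exp (- \<eta> * x$3) * (?B * ?l)" .
  qed
  then have "norm (V_M x m) \<le> 1 / (2 * \<eta> * ?l\<^sup>2) * (2 * exp (- \<eta> * x$3) * (?B * ?l))"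
    unfolding V_M_def norm_vector_scalar_mult_complex using \<eta>(4)
    by (intro mult_mono) (auto simp: coeff_c_def \<eta>(1) norm_divide norm_mult norm_power mult_ac)
  then have "K_M x r m \<le> 1 / (2 * \<eta> * ?l\<^sup>2) * (2 * exp (- \<eta> * x$3) * (?B * ?l)) * (exp (\<eta> * r) * (?B * ?l))"
    unfolding K_M_def norm_exp_evanescent[OF \<eta>(1)] using l unit_bound_pos by (intro mult_right_mono) auto
  also have "\<dots> = ?B\<^sup>2 / \<eta> * (exp (- \<eta> * x$3) * exp (\<eta> * r))"
    using l \<eta>(4) by (simp add: field_simps power2_eq_square)
  also have "\<dots> \<le> ?B\<^sup>2 / (lam (Suc M) - k) * (exp ((x$3 - r) * k) * exp (- (x$3 - r) * ?l))"
    by (rule mult_mono[OF frac_le exp_decay_le[OF \<eta>(3) assms(1)]]) (use \<eta> lam_M in auto)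
  finally show "norm (K_M x r (Suc m')) \<le> ?C * exp (- (x$3 - r) * lam (Suc m'))"
    using l unit_bound_pos by (simp add: m_def mult.assoc K_M_def)
qed

text \<open>Both axial amplitudes grow like mu^2 and the coefficient gives back only 1 / mu^2, so a
  factor mu^2 survives beside the exponential. The constant 4 collects four fields in the standing
  wave, two on the slice, and the 1/2 in \<open>coeff_d\<close>.\<close>

lemma summable_K_PQ:
  assumes "r < x$3" "x$3 < 0"
  shows "summable (\<lambda>n. K_PQ x r (Suc n))"
proof (rule summable_comparison_test')
  let ?C = "4 * unit_bound\<^sup>2 / (k\<^sup>2 * (mu (Suc N) - k)) * exp ((x$3 - r) * k)"
  show "summable (\<lambda>n. ?C * ((mu (Suc n))\<^sup>2 * exp (- (x$3 - r) * mu (Suc n))))"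
    using assms summable_square_exp[of "\<lambda>n. mu (Suc n)" "x$3 - r"] summable_mu mu_nonneg
    by (intro summable_mult) auto
  fix n' assume "n' \<ge> N"
  define n where "n = Suc n'"
  have n: "n > N" "n \<ge> 1"
    using \<open>n' \<ge> N\<close> by (auto simp: n_def)
  obtain \<eta> where \<eta>: "g n = \<i> * of_real \<eta>" "\<eta> \<ge> mu (Suc N) - k" "\<eta> \<ge> mu n - k" "\<eta> > 0" "\<eta> \<le> mu n"
    using g_evanescent[OF n(1)] .
  let ?l = "mu n" and ?B = "unit_bound"
  have l: "?l > 0" using mu_pos n by simp
  let ?b = "?B * ?l\<^sup>2 / k"
  have b: "?b > 0" using l unit_bound_pos k_pos by simp
  \<comment> \<open>Because \<eta> is at most mu_n, the tangential amplitude is dominated by the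
    axial one, and a single bound \<open>?b\<close> serves for all fields.\<close>
  have P_le_Q: "norm (g n) / k * (?B * ?l) \<le> ?b"
  proof -
    have "\<eta> * (?B * ?l / k) \<le> ?l * (?B * ?l / k)"
      using \<eta> l unit_bound_pos k_pos by (intro mult_right_mono) auto
    then show ?thesis
      using \<eta> by (simp add: norm_mult power2_eq_square mult_ac)
  qed
  let ?e = "exp (- \<eta> * x$3)"
  have fields: "norm (field_P n y) \<le> ?e * ?b" "norm (field_Q n y) \<le> ?e * ?b"
    if y: "y$3 = x$3 \<or> y$3 = - x$3" for y
  proof -
    have "norm (exp (\<i> * g n * of_real (y$3))) \<le> ?e"
      unfolding norm_exp_evanescent[OF \<eta>(1)] using y assms \<eta>(4)
      by (auto simp: mult_nonneg_nonpos intro: order_trans[of _ 0])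
    then have *: "norm (exp (\<i> * g n * of_real (y$3))) * c \<le> ?e * ?b" if "0 \<le> c" "c \<le> ?b" for c
      using that by (intro mult_mono) auto
    show "norm (field_P n y) \<le> ?e * ?b"
      by (rule order_trans[OF norm_field_PQ_le(1)[OF n(2)] *])
         (use P_le_Q l unit_bound_pos k_pos in auto)
    show "norm (field_Q n y) \<le> ?e * ?b"
      by (rule order_trans[OF norm_field_PQ_le(2)[OF n(2)] *]) (use b in auto)
  qed
  have "norm (standing_PQ n x) \<le> (?e * ?b + ?e * ?b) + (?e * ?b + ?e * ?b)"
    unfolding standing_PQ_def
    by (intro order_trans[OF norm_triangle_ineq] add_mono order_trans[OF norm_triangle_ineq4] fields) auto
  then have "norm (V_PQ x n) \<le> 1 / (2 * \<eta> * ?l\<^sup>2) * (4 * ?e * ?b)"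
    unfolding V_PQ_def norm_vector_scalar_mult_complex using \<eta>(4)
    by (intro mult_mono) (auto simp: coeff_d_def \<eta>(1) norm_divide norm_mult norm_power mult_ac)
  moreover have "norm (g n) / k * (?B * ?l) + ?b \<le> 2 * ?b"
    using P_le_Q by simp
  ultimately have "K_PQ x r n \<le> 1 / (2 * \<eta> * ?l\<^sup>2) * (4 * ?e * ?b) * (exp (\<eta> * r) * (2 * ?b))"
    unfolding K_PQ_def norm_exp_evanescent[OF \<eta>(1)] using l unit_bound_pos k_pos \<eta>(4)
    by (intro mult_mono) auto
  also have "\<dots> = 4 * ?B\<^sup>2 * ?l\<^sup>2 / (k\<^sup>2 * \<eta>) * (?e * exp (\<eta> * r))"
    using l \<eta>(4) k_pos by (simp add: field_simps power2_eq_square)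
  also have "\<dots> \<le> 4 * ?B\<^sup>2 * ?l\<^sup>2 / (k\<^sup>2 * (mu (Suc N) - k)) * (exp ((x$3 - r) * k) * exp (- (x$3 - r) * ?l))"
    by (rule mult_mono[OF frac_le exp_decay_le[OF \<eta>(3) assms(1)]]) (use \<eta> mu_N k_pos in auto)
  finally show "norm (K_PQ x r (Suc n')) \<le> ?C * ((mu (Suc n'))\<^sup>2 * exp (- (x$3 - r) * mu (Suc n')))"
    using l unit_bound_pos k_pos by (simp add: n_def mult_ac K_PQ_def)
qed

end

section \<open>Action of the operator on the test function\<close>

lemma dotc_diff_left: "dotc (v - v') w = dotc v w - dotc v' w"
  by (simp add: dotc_def algebra_simps sum_subtractf)

lemma with_x3_nth [simp]: "with_x3 x t $ 1 = x $ 1" "with_x3 x t $ 2 = x $ 2" "with_x3 x t $ 3 = t"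
  by (simp_all add: with_x3_def)

lemma with_x3_self [simp]: "with_x3 x (x $ 3) = x"
  by (simp add: with_x3_def vec_eq_iff forall_3)

text \<open>A Green term is defined by cases and is a single exponential only on one side of the
  plane where the cases meet; agreement on an open set around the point is enough. The derivative is
  expressed through F itself, which keeps the amplitude K out of later statements.\<close>

lemma vector_derivative_exp_mult:
  fixes F :: "real \<Rightarrow> complex^3^3"
  assumes "open S" "t0 \<in> S" and F: "\<And>t. t \<in> S \<Longrightarrow> F t = (\<chi> i j. exp (c * of_real t) * K $ i $ j)"
  shows "vector_derivative F (at t0) = (\<chi> i j. c * F t0 $ i $ j)"
proof (rule vector_derivative_at)
  have "bounded_linear (\<lambda>w. \<chi> i j. w * K $ i $ j)"
    unfolding linear_conv_bounded_linear[symmetric]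
    by (rule linearI) (simp_all add: vec_eq_iff algebra_simps)
  moreover have "((\<lambda>t. exp (c * of_real t)) has_vector_derivative c * exp (c * of_real t0)) (at t0)"
    by (auto intro!: derivative_eq_intros has_vector_derivative_real_field)
  ultimately have "((\<lambda>t. \<chi> i j. exp (c * of_real t) * K $ i $ j) has_vector_derivative
      (\<chi> i j. (c * exp (c * of_real t0)) * K $ i $ j)) (at t0)"
    by (rule bounded_linear.has_vector_derivative)
  then have "(F has_vector_derivative (\<chi> i j. (c * exp (c * of_real t0)) * K $ i $ j)) (at t0)"
    by (rule has_vector_derivative_transform_within_open[OF _ assms(1,2)]) (simp add: F)
  then show "(F has_vector_derivative (\<chi> i j. c * F t0 $ i $ j)) (at t0)"
    by (simp add: F[OF assms(2)] mult.assoc)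
qed

text \<open>For a real propagation constant the phase of the Green term on the slice cancels against
  the conjugate phase in Psi, so that the final value does not depend on r.\<close>

lemma exp_mult_cnj_exp:
  "exp (- (\<i> * complex_of_real \<kappa> * of_real r)) * cnj (exp (- (\<i> * complex_of_real \<kappa> * of_real r))) = 1"
  by (simp add: exp_cnj flip: exp_add)

section \<open>The test function on the slice and the image under the operator\<close>

context waveguide_modes
begin

text \<open>Coordinate of Psi e_j along the profile \<open>rot_u m\<close>; it collects the entire
  dependence on z, j and r.\<close>

definition A_M :: "real^3 \<Rightarrow> 3 \<Rightarrow> real \<Rightarrow> nat \<Rightarrow> complex" where
  "A_M z j r m = - \<i> * (h m / (2 * of_real ((lam m)\<^sup>2))) * cnj (exp (- (\<i> * h m * of_real r)))
     * cnj_vec (field_M m z - field_M m (mirror z)) $ j"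

definition A_PQ :: "real^3 \<Rightarrow> 3 \<Rightarrow> real \<Rightarrow> nat \<Rightarrow> complex" where
  "A_PQ z j r n = \<i> * (of_real (k\<^sup>2) / (2 * of_real ((mu n)\<^sup>2) * g n))
     * cnj (\<i> * g n / of_real k * exp (- (\<i> * g n * of_real r))) * cnj_vec (standing_PQ n z) $ j"

definition source :: "real^3 \<Rightarrow> 3 \<Rightarrow> real \<Rightarrow> real^3 \<Rightarrow> complex^3" where
  "source z j r y = (\<Sum>m=1..M. A_M z j r m *s cvec (rot_u m (y$1, y$2)))
     + (\<Sum>n=1..N. A_PQ z j r n *s cvec (grad_v n (y$1, y$2)))"

lemma Psi_slice:
  assumes "y \<in> slice r"
  shows "Psi M N y z *v axis j 1 = source z j r y"
proof -
  have y: "y $ 3 = r"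
    using assms by (simp add: slice_def)
  show ?thesis
    unfolding vec_eq_iff mult_vec_axis_nth
    by (simp add: Psi_def source_def outer_def A_M_def A_PQ_def field_M_eq[of _ "mirror y"]
        field_P_eq[of _ "mirror y"] cnj_vec_scaled_cvec standing_PQ_def y)
       (simp add: cnj_vec_def mult_ac)
qed

lemma borel_measurable_source: "source z j r \<in> borel_measurable (slice_measure r)"
  unfolding source_def[abs_def]
  by (intro borel_measurable_add borel_measurable_sum borel_measurable_profiles)

lemma source_bounded: obtains B where "\<And>y. norm (source z j r y) \<le> B"
proof (rule that)
  fix y
  show "norm (source z j r y) \<le> (\<Sum>m=1..M. norm (A_M z j r m) * (unit_bound * lam m))
     + (\<Sum>n=1..N. norm (A_PQ z j r n) * (unit_bound * mu n))"
    unfolding source_def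
    by (intro order_trans[OF norm_triangle_ineq] add_mono sum_norm_le)
       (simp_all add: mult_left_mono norm_rot_u_le norm_grad_v_le n_pos)
qed

text \<open>The operator has a value only on \<open>L2t r\<close>. On the slice the test function is
  bounded, the measure is finite, and its profiles have no axial component.\<close>

lemma Psi_in_L2t: "(\<lambda>y. Psi M N y z *v axis j 1) \<in> L2t r"
proof -
  interpret finite_measure "slice_measure r" by (rule finite_slice_measure)
  have meas: "(\<lambda>y. Psi M N y z *v axis j 1) \<in> borel_measurable (slice_measure r)"
    using borel_measurable_source by (rule measurable_cong[THEN iffD2, rotated]) (simp add: Psi_slice)
  obtain B where B: "norm (source z j r y) \<le> B" for y
    using source_bounded[of z j r] by blast
  have "integrable (slice_measure r) (\<lambda>y. (norm (Psi M N y z *v axis j 1))\<^sup>2)"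
  proof (rule integrable_const_bound[of _ "B\<^sup>2"])
    show "AE y in slice_measure r. norm ((norm (Psi M N y z *v axis j 1))\<^sup>2) \<le> B\<^sup>2"
      by (auto simp: Psi_slice intro!: power_mono B)
    show "(\<lambda>y. (norm (Psi M N y z *v axis j 1))\<^sup>2) \<in> borel_measurable (slice_measure r)"
      using meas by measurable
  qed
  with meas show ?thesis
    by (auto simp: L2t_def Psi_slice source_def)
qed

lemma integral_W_M_source:
  "(LINT y|slice_measure r. dotc (W_M r m y) (source z j r y))
    = (if m \<in> {1..M} then exp (- (\<i> * h m * of_real r)) * A_M z j r m * of_real ((lam m)\<^sup>2) else 0)"
proof -
  let ?e = "exp (- (\<i> * h m * of_real r))"
  let ?F = "\<lambda>p. (\<Sum>m'=1..M. (?e * A_M z j r m') * of_real (rot_u m p \<bullet> rot_u m' p))"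
  let ?G = "\<lambda>p. (\<Sum>n=1..N. (?e * A_PQ z j r n) * of_real (rot_u m p \<bullet> grad_v n p))"
  have "(LINT y|slice_measure r. dotc (W_M r m y) (source z j r y))
      = (LINT p:cross_section|lborel. dotc (W_M r m (slice_point r p)) (source z j r (slice_point r p)))"
    by (intro integral_slice_measure borel_measurable_dotc measurable_W borel_measurable_source)
  also have "(\<lambda>p. dotc (W_M r m (slice_point r p)) (source z j r (slice_point r p))) = (\<lambda>p. ?F p + ?G p)"
    by (simp add: fun_eq_iff W_M_def source_def dotc_add_right dotc_sum_right dotc_scaled_cvec)
  also have "(LINT p:cross_section|lborel. ?F p + ?G p)
      = (LINT p:cross_section|lborel. ?F p) + (LINT p:cross_section|lborel. ?G p)"
    by (intro set_integral_add set_integral_cross_section_sum continuous_inner_profiles) auto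
  also have "(LINT p:cross_section|lborel. ?F p)
      = (\<Sum>m'=1..M. (?e * A_M z j r m') * of_real (if m = m' then (lam m)\<^sup>2 else 0))"
    by (subst set_integral_cross_section_sum)
       (auto simp: rot_u_orthonormal[OF bij_is_inj[OF bij_mi]] intro: continuous_inner_profiles)
  also have "(LINT p:cross_section|lborel. ?G p) = 0"
    by (subst set_integral_cross_section_sum)
       (auto simp: rot_u_grad_v_orthogonal n_pos intro: continuous_inner_profiles)
  finally show ?thesis
    by (simp add: if_distrib if_distribR sum.delta cong: if_cong)
qed

lemma integral_W_PQ_source:
  assumes "n \<ge> 1"
  shows "(LINT y|slice_measure r. dotc (W_PQ r n y) (source z j r y))
    = (if n \<in> {1..N} then \<i> * g n / of_real k * exp (- (\<i> * g n * of_real r)) * A_PQ z j r n * of_real ((mu n)\<^sup>2) else 0)"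
proof -
  let ?e = "\<i> * g n / of_real k * exp (- (\<i> * g n * of_real r))"
  let ?F = "\<lambda>p. (\<Sum>m=1..M. (?e * A_M z j r m) * of_real (grad_v n p \<bullet> rot_u m p))"
  let ?G = "\<lambda>p. (\<Sum>n'=1..N. (?e * A_PQ z j r n') * of_real (grad_v n p \<bullet> grad_v n' p))"
  have inj: "inj_on ni {1..}"
    using bij_ni by (rule bij_betw_imp_inj_on)
  have "(LINT y|slice_measure r. dotc (W_PQ r n y) (source z j r y))
      = (LINT p:cross_section|lborel. dotc (W_PQ r n (slice_point r p)) (source z j r (slice_point r p)))"
    by (intro integral_slice_measure borel_measurable_dotc measurable_W borel_measurable_source)
  \<comment> \<open>The axial part of \<open>W_PQ\<close> disappears pointwise, because the source
    is tangential.\<close>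
  also have "(\<lambda>p. dotc (W_PQ r n (slice_point r p)) (source z j r (slice_point r p))) = (\<lambda>p. ?F p + ?G p)"
    using axial_v_orth
    by (simp add: fun_eq_iff W_PQ_def source_def dotc_diff_left dotc_add_right dotc_sum_right
        dotc_scaled_cvec inner_commute[of "axial_v _ _"])
  also have "(LINT p:cross_section|lborel. ?F p + ?G p)
      = (LINT p:cross_section|lborel. ?F p) + (LINT p:cross_section|lborel. ?G p)"
    by (intro set_integral_add set_integral_cross_section_sum continuous_inner_profiles) auto
  also have "(LINT p:cross_section|lborel. ?F p) = 0"
    by (subst set_integral_cross_section_sum)
       (auto simp: inner_commute[of "grad_v _ _"] rot_u_grad_v_orthogonal[OF n_pos[OF assms]]
         intro: continuous_inner_profiles)
  also have "(LINT p:cross_section|lborel. ?G p)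
      = (\<Sum>n'=1..N. (?e * A_PQ z j r n') * of_real (if n = n' then (mu n)\<^sup>2 else 0))"
    using assms
    by (subst set_integral_cross_section_sum)
       (auto simp: grad_v_orthonormal[OF inj] n_pos intro: continuous_inner_profiles)
  finally show ?thesis
    by (simp add: if_distrib if_distribR sum.delta cong: if_cong)
qed

text \<open>Since r < x_3, only the branch of the Green function with the standing wave in x is
  used, whatever the position of z. The image has an axial component although the source has none:
  it comes from \<open>V_PQ\<close>.\<close>

lemma op_H_Psi:
  assumes "x \<in> D" "r < x$3" "x$3 < 0"
  shows "op_H r D (\<lambda>y. Psi M N y z *v axis j 1) x
    = (\<Sum>m=1..M. (exp (- (\<i> * h m * of_real r)) * A_M z j r m * of_real ((lam m)\<^sup>2)) *s V_M x m)
    + (\<Sum>n=1..N. (\<i> * g n / of_real k * exp (- (\<i> * g n * of_real r)) * A_PQ z j r n * of_real ((mu n)\<^sup>2)) *s V_PQ x n)"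
    (is "_ = ?R1 + ?R2")
proof -
  let ?S = "source z j r"
  let ?GM = "\<lambda>y. \<Sum>m. green_term_M (Suc m) x y" and ?GPQ = "\<lambda>y. \<Sum>n. green_term_PQ (Suc n) x y"
  obtain B where B: "norm (?S y) \<le> B" for y
    using source_bounded[of z j r] by blast
  note sum_M = integral_modal_sum[OF finite_slice_measure measurable_W(1) borel_measurable_source
      V_W_M_le B summable_K_M[OF assms(2,3)] green_term_M_slice[OF _ assms(2)], unfolded space_slice_measure]
  note sum_PQ = integral_modal_sum[OF finite_slice_measure measurable_W(2) borel_measurable_source
      V_W_PQ_le B summable_K_PQ[OF assms(2,3)] green_term_PQ_slice[OF _ assms(2)], unfolded space_slice_measure]
  have "op_H r D (\<lambda>y. Psi M N y z *v axis j 1) x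
      = (LINT y|slice_measure r. green x y *v (Psi M N y z *v axis j 1))"
    using assms(1) Psi_in_L2t by (simp add: op_H_def)
  also have "\<dots> = (LINT y|slice_measure r. ?GM y *v ?S y + ?GPQ y *v ?S y)"
    by (intro Bochner_Integration.integral_cong)
       (simp_all add: Psi_slice green_def modal_series_def matrix_vector_mult_add_rdistrib)
  also have "\<dots> = (LINT y|slice_measure r. ?GM y *v ?S y) + (LINT y|slice_measure r. ?GPQ y *v ?S y)"
    by (intro Bochner_Integration.integral_add sum_M(1) sum_PQ(1)) auto
  also have "(LINT y|slice_measure r. ?GM y *v ?S y)
      = (\<Sum>m. (LINT y|slice_measure r. dotc (W_M r (Suc m) y) (?S y)) *s V_M x (Suc m))"
    by (rule sum_M(2)) auto
  \<comment> \<open>The overlaps vanish for every index above M, so the infinite series is a finite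
    sum.\<close>
  also have "\<dots> = (\<Sum>m=1..M. (LINT y|slice_measure r. dotc (W_M r m y) (?S y)) *s V_M x m)"
    by (rule suminf_Suc_eq_sum) (simp add: integral_W_M_source)
  also have "\<dots> = ?R1"
    by (intro sum.cong) (simp_all add: integral_W_M_source)
  also have "(LINT y|slice_measure r. ?GPQ y *v ?S y)
      = (\<Sum>n. (LINT y|slice_measure r. dotc (W_PQ r (Suc n) y) (?S y)) *s V_PQ x (Suc n))"
    by (rule sum_PQ(2)) auto
  also have "\<dots> = (\<Sum>n=1..N. (LINT y|slice_measure r. dotc (W_PQ r n y) (?S y)) *s V_PQ x n)"
    by (rule suminf_Suc_eq_sum) (simp add: integral_W_PQ_source)
  also have "\<dots> = ?R2"
    by (intro sum.cong) (simp_all add: integral_W_PQ_source)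
  finally show ?thesis .
qed

section \<open>Axial derivatives of the Green terms\<close>

lemma vector_derivative_green_term_x3:
  assumes "x$3 < z$3"
  shows "vector_derivative (\<lambda>t. green_term_M m (with_x3 x t) z) (at (x$3))
      = (\<chi> i j. - (\<i> * h m) * green_term_M m x z $ i $ j)" (is ?M)
    and "vector_derivative (\<lambda>t. green_term_PQ n (with_x3 x t) z) (at (x$3))
      = (\<chi> i j. - (\<i> * g n) * green_term_PQ n x z $ i $ j)" (is ?PQ)
proof -
  let ?K = "\<chi> i j. coeff_c m * of_real (rot_u m (x$1, x$2) $ i) * (field_M m z - field_M m (mirror z)) $ j"
  have "green_term_M m (with_x3 x t) z = (\<chi> i j. exp (- (\<i> * h m) * of_real t) * ?K $ i $ j)"
    if "t \<in> {..<z$3}" for t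
    using that by (simp add: green_term_M_def outer_def vec_eq_iff field_M_eq mult_ac)
  from vector_derivative_exp_mult[OF open_lessThan _ this] assms show ?M
    by simp
  let ?K = "\<chi> i j. coeff_d n * (\<i> * g n / of_real k * of_real (grad_v n (x$1, x$2) $ i)
    - 1 / of_real k * of_real (axial_v n (x$1, x$2) $ i)) * standing_PQ n z $ j"
  have "green_term_PQ n (with_x3 x t) z = (\<chi> i j. exp (- (\<i> * g n) * of_real t) * ?K $ i $ j)"
    if "t \<in> {..<z$3}" for t
    using that
    by (simp add: green_term_PQ_def outer_def vec_eq_iff field_P_eq[of _ "mirror (with_x3 x t)"]
        field_Q_eq[of _ "mirror (with_x3 x t)"] flip: standing_PQ_def) (simp add: algebra_simps)
  from vector_derivative_exp_mult[OF open_lessThan _ this] assms show ?PQ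
    by simp
qed

text \<open>Here z carries the travelling wave, and the result is the same multiple of the Green
  term as for the derivative in x_3; this is what merges the two cases of the claim.\<close>

lemma vector_derivative_green_term_z3:
  assumes "z$3 < x$3"
  shows "vector_derivative (\<lambda>t. green_term_M m x (with_x3 z t)) (at (z$3))
      = (\<chi> i j. - (\<i> * h m) * green_term_M m x z $ i $ j)" (is ?M)
    and "vector_derivative (\<lambda>t. green_term_PQ n x (with_x3 z t)) (at (z$3))
      = (\<chi> i j. - (\<i> * g n) * green_term_PQ n x z $ i $ j)" (is ?PQ)
proof -
  let ?K = "\<chi> i j. V_M x m $ i * of_real (rot_u m (z$1, z$2) $ j)"
  have "green_term_M m x (with_x3 z t) = (\<chi> i j. exp (- (\<i> * h m) * of_real t) * ?K $ i $ j)"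
    if "t \<in> {..<x$3}" for t
    using that
    by (simp add: green_term_M_def outer_def vec_eq_iff field_M_eq[of _ "mirror (with_x3 z t)"] V_M_def)
  from vector_derivative_exp_mult[OF open_lessThan _ this] assms show ?M
    by simp
  let ?K = "\<chi> i j. V_PQ x n $ i * (\<i> * g n / of_real k * of_real (grad_v n (z$1, z$2) $ j)
    - 1 / of_real k * of_real (axial_v n (z$1, z$2) $ j))"
  have "green_term_PQ n x (with_x3 z t) = (\<chi> i j. exp (- (\<i> * g n) * of_real t) * ?K $ i $ j)"
    if "t \<in> {..<x$3}" for t
    using that
    by (simp add: green_term_PQ_def outer_def vec_eq_iff field_P_eq[of _ "mirror (with_x3 z t)"]
        field_Q_eq[of _ "mirror (with_x3 z t)"] V_PQ_def flip: standing_PQ_def) (simp add: algebra_simps)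
  from vector_derivative_exp_mult[OF open_lessThan _ this] assms show ?PQ
    by simp
qed

section \<open>Closed forms of the propagating terms on both sides\<close>

lemma standing_M_propagating:
  assumes "h m = of_real \<kappa>"
  shows "field_M m x - field_M m (mirror x) = (2 * \<i> * of_real (sin (\<kappa> * x$3))) *s cvec (rot_u m (x$1, x$2))"
proof -
  have "exp (\<i> * of_real \<kappa> * of_real (x$3)) = cis (\<kappa> * x$3)"
    "exp (- (\<i> * of_real \<kappa> * of_real (x$3))) = cis (- (\<kappa> * x$3))"
    by (simp_all add: cis_conv_exp mult.assoc)
  then show ?thesis
    by (simp add: field_M_eq assms vec_eq_iff) (simp add: complex_eq_iff algebra_simps)
qed

text \<open>The difference of the P fields gives i \<gamma> times 2i times a sine, the sum of the Q
  fields twice a cosine: the standing wave is real, and the conjugation in Psi leaves it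
  unchanged.\<close>

lemma standing_PQ_propagating:
  assumes "g n = of_real \<gamma>"
  shows "standing_PQ n x = cvec ((2 / k) *\<^sub>R
    (cos (\<gamma> * x$3) *\<^sub>R axial_v n (x$1, x$2) - (\<gamma> * sin (\<gamma> * x$3)) *\<^sub>R grad_v n (x$1, x$2)))"
proof -
  have "exp (\<i> * of_real \<gamma> * of_real (x$3)) = cis (\<gamma> * x$3)"
    "exp (- (\<i> * of_real \<gamma> * of_real (x$3))) = cis (- (\<gamma> * x$3))"
    by (simp_all add: cis_conv_exp mult.assoc)
  then show ?thesis
    using k_pos
    by (simp add: standing_PQ_def field_P_eq field_Q_eq assms vec_eq_iff)
       (simp add: complex_eq_iff field_simps)
qed

text \<open>The standing wave is purely imaginary here, so conjugation flips its sign at z. The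
  factor \<kappa> in Psi cancels the 1/\<kappa> in \<open>coeff_c\<close>, and the overlap
  \<open>(lam m)\<^sup>2\<close> cancels one of the two factors 1 / lambda^2.\<close>

lemma op_H_coefficient_M:
  assumes "m \<in> {1..M}"
  defines "\<kappa> \<equiv> sqrt (k\<^sup>2 - (lam m)\<^sup>2)"
  shows "((exp (- (\<i> * h m * of_real r)) * A_M z j r m * of_real ((lam m)\<^sup>2)) *s V_M x m) $ i
    = of_real (sin (\<kappa> * x$3) * sin (\<kappa> * z$3) / (lam m)\<^sup>2 * rot_u m (x$1, x$2) $ i * rot_u m (z$1, z$2) $ j)"
proof -
  have h: "h m = of_real \<kappa>" and "\<kappa> > 0" and l: "lam m > 0"
    using assms h_propagating[of m] lam_pos[of m] by auto
  let ?e = "exp (- (\<i> * h m * of_real r))"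
  have "((?e * A_M z j r m * of_real ((lam m)\<^sup>2)) *s V_M x m) $ i
    = (?e * cnj ?e) * ((- \<i> * (of_real \<kappa> / (2 * of_real ((lam m)\<^sup>2)))) * (- 2 * \<i> * of_real (sin (\<kappa> * z$3)) * of_real (rot_u m (z$1, z$2) $ j))
      * of_real ((lam m)\<^sup>2) * (\<i> / (2 * of_real \<kappa> * of_real ((lam m)\<^sup>2)) * (2 * \<i> * of_real (sin (\<kappa> * x$3)) * of_real (rot_u m (x$1, x$2) $ i))))"
    by (simp add: A_M_def V_M_def standing_M_propagating[OF h] cnj_vec_scaled_cvec coeff_c_def
        del: vector_ssub_ldistrib) (simp add: h mult_ac)
  also have "?e * cnj ?e = 1"
    unfolding h by (rule exp_mult_cnj_exp)
  finally show ?thesis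
    using \<open>\<kappa> > 0\<close> l by (simp add: field_simps)
qed

text \<open>The two amplitudes i \<gamma> / k and -i \<gamma> / k, the weight k^2 / \<gamma> of Psi
  and the 1 / \<gamma> in \<open>coeff_d\<close> multiply to a real number without \<gamma> and k;
  the 4 joins the factors 1/2 of Psi and of \<open>coeff_d\<close>.\<close>

lemma op_H_coefficient_PQ:
  assumes "n \<in> {1..N}"
  shows "((\<i> * g n / of_real k * exp (- (\<i> * g n * of_real r)) * A_PQ z j r n * of_real ((mu n)\<^sup>2)) *s V_PQ x n) $ i
    = standing_PQ n x $ i * standing_PQ n z $ j / of_real (4 * (mu n)\<^sup>2)"
proof -
  define \<gamma> where "\<gamma> = sqrt (k\<^sup>2 - (mu n)\<^sup>2)"
  have g: "g n = of_real \<gamma>" and "\<gamma> > 0" and l: "mu n > 0"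
    using assms g_propagating[of n] mu_pos[of n] by (auto simp: \<gamma>_def)
  let ?e = "exp (- (\<i> * g n * of_real r))"
  have cnj: "cnj_vec (standing_PQ n z) $ j = standing_PQ n z $ j"
    unfolding standing_PQ_propagating[OF g] by (simp add: cnj_vec_def)
  have "((\<i> * g n / of_real k * ?e * A_PQ z j r n * of_real ((mu n)\<^sup>2)) *s V_PQ x n) $ i
    = (?e * cnj ?e) * (\<i> * of_real \<gamma> / of_real k * (\<i> * (of_real (k\<^sup>2) / (2 * of_real ((mu n)\<^sup>2) * of_real \<gamma>))
     * (- \<i> * of_real \<gamma> / of_real k) * standing_PQ n z $ j) * of_real ((mu n)\<^sup>2)
     * (- (\<i> / (2 * of_real \<gamma> * of_real ((mu n)\<^sup>2))) * standing_PQ n x $ i))"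
    by (simp add: A_PQ_def V_PQ_def cnj coeff_d_def) (simp add: g mult_ac)
  also have "?e * cnj ?e = 1"
    unfolding g by (rule exp_mult_cnj_exp)
  finally show ?thesis
    using \<open>\<gamma> > 0\<close> l k_pos by (simp add: field_simps power2_eq_square)
qed

text \<open>The prefactor is real, so the real part falls on 2i sin (\<kappa> s) cis (-\<kappa> t),
  where s and t are the third coordinates of x and z in either order. It equals 2 sin (\<kappa> s)
  sin (\<kappa> t), the same in both orders.\<close>

lemma Re_derivative_green_term_M:
  assumes "m \<in> {1..M}" "x$3 \<noteq> z$3"
  defines "\<kappa> \<equiv> sqrt (k\<^sup>2 - (lam m)\<^sup>2)"
  shows "Re (- (\<i> * h m) * green_term_M m x z $ i $ j)
    = sin (\<kappa> * x$3) * sin (\<kappa> * z$3) / (lam m)\<^sup>2 * rot_u m (x$1, x$2) $ i * rot_u m (z$1, z$2) $ j"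
proof -
  have h: "h m = of_real \<kappa>" and "\<kappa> > 0" and l: "lam m > 0"
    using assms h_propagating[of m] lam_pos[of m] by auto
  have c: "- (\<i> * h m) * coeff_c m = of_real (1 / (2 * (lam m)\<^sup>2))"
    using \<open>\<kappa> > 0\<close> by (simp add: h coeff_c_def)
  have mirror: "field_M m (mirror y) = cis (- (\<kappa> * y$3)) *s cvec (rot_u m (y$1, y$2))" for y
    by (simp add: field_M_eq h cis_conv_exp mult.assoc)
  have "- (\<i> * h m) * green_term_M m x z $ i $ j = (- (\<i> * h m) * coeff_c m) *
    (if x$3 > z$3
     then (2 * \<i> * of_real (sin (\<kappa> * x$3)) * cis (- (\<kappa> * z$3)))
     else (2 * \<i> * of_real (sin (\<kappa> * z$3)) * cis (- (\<kappa> * x$3))))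
     * of_real (rot_u m (x$1, x$2) $ i * rot_u m (z$1, z$2) $ j)"
    unfolding green_term_M_def standing_M_propagating[OF h] unfolding mirror by (simp add: outer_def)
  then show ?thesis
    unfolding c by (simp add: field_simps)
qed

text \<open>The prefactor -1 / (2 mu^2) and the standing wave are real, so the real part falls on
  the travelling factor, which contributes minus half of a standing wave; the signs cancel and 2
  times 2 gives the 4.\<close>

lemma Re_derivative_green_term_PQ:
  assumes "n \<in> {1..N}" "x$3 \<noteq> z$3"
  shows "of_real (Re (- (\<i> * g n) * green_term_PQ n x z $ i $ j))
    = standing_PQ n x $ i * standing_PQ n z $ j / of_real (4 * (mu n)\<^sup>2)"
proof -
  define \<gamma> where "\<gamma> = sqrt (k\<^sup>2 - (mu n)\<^sup>2)"
  have g: "g n = of_real \<gamma>" and "\<gamma> > 0" and l: "mu n > 0"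
    using assms g_propagating[of n] mu_pos[of n] by (auto simp: \<gamma>_def)
  have d: "- (\<i> * g n) * coeff_d n = of_real (- 1 / (2 * (mu n)\<^sup>2))"
    using \<open>\<gamma> > 0\<close> by (simp add: g coeff_d_def)
  define S where "S y = (2 / k) *\<^sub>R
    (cos (\<gamma> * y$3) *\<^sub>R axial_v n (y$1, y$2) - (\<gamma> * sin (\<gamma> * y$3)) *\<^sub>R grad_v n (y$1, y$2))" for y :: "real^3"
  have S: "standing_PQ n y = cvec (S y)" for y
    unfolding S_def by (rule standing_PQ_propagating[OF g])
  \<comment> \<open>For real \<open>g n\<close>, conjugation sends P(y^-) to -P(y) and Q(y^-) to
    Q(y), so the travelling wave plus its conjugate is minus the standing wave.\<close>
  have travelling: "Re ((field_P n (mirror y) - field_Q n (mirror y)) $ i) = - (S y $ i / 2)" for y i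
  proof -
    have "exp (- (\<i> * of_real \<gamma> * of_real (y$3))) = cis (- (\<gamma> * y$3))"
      by (simp add: cis_conv_exp mult.assoc)
    then show ?thesis
      using k_pos by (simp add: field_P_eq field_Q_eq g S_def) (simp add: field_simps)
  qed
  have Re_real: "Re (of_real p * of_real q * w) = p * q * Re w" for p q :: real and w :: complex
    by simp
  have "Re (- (\<i> * g n) * green_term_PQ n x z $ i $ j) = S x $ i * S z $ j / (4 * (mu n)\<^sup>2)"
  proof (cases "x$3 > z$3")
    case True
    have "- (\<i> * g n) * green_term_PQ n x z $ i $ j
      = (- (\<i> * g n) * coeff_d n) * of_real (S x $ i) * (field_P n (mirror z) - field_Q n (mirror z)) $ j"
      using True by (simp add: green_term_PQ_def outer_def S flip: standing_PQ_def)
    then show ?thesis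
      unfolding d by (simp only: Re_real travelling) simp
  next
    case False
    have "- (\<i> * g n) * green_term_PQ n x z $ i $ j
      = (- (\<i> * g n) * coeff_d n) * of_real (S z $ j) * (field_P n (mirror x) - field_Q n (mirror x)) $ i"
      using False by (simp add: green_term_PQ_def outer_def S flip: standing_PQ_def)
        (simp add: algebra_simps)
    then show ?thesis
      unfolding d by (simp only: Re_real travelling) simp
  qed
  then show ?thesis
    by (simp add: S)
qed

text \<open>The two finite sums agree mode by mode: the coefficient produced by the operator and the
  real part of the differentiated Green term have been brought to the same closed form.\<close>

lemma op_H_Psi_eq_prop_Re_green:
  assumes "x \<in> D" "r < x$3" "x$3 < 0" "x$3 \<noteq> z$3"
  shows "op_H r D (\<lambda>y. Psi M N y z *v axis j 1) x
    = (if x$3 < z$3 then prop_Re_green_dx3 M N x z j else prop_Re_green_dz3 M N x z j)"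
proof -
  have "(exp (- (\<i> * h m * of_real r)) * A_M z j r m * of_real ((lam m)\<^sup>2)) *s V_M x m
      = Re_mat (\<chi> i j. - (\<i> * h m) * green_term_M m x z $ i $ j) *v axis j 1" if "m \<in> {1..M}" for m
    unfolding vec_eq_iff op_H_coefficient_M[OF that] mult_vec_axis_nth
    by (simp only: Re_mat_def vec_lambda_beta Re_derivative_green_term_M[OF that assms(4)]) simp
  moreover have "(\<i> * g n / of_real k * exp (- (\<i> * g n * of_real r)) * A_PQ z j r n * of_real ((mu n)\<^sup>2)) *s V_PQ x n
      = Re_mat (\<chi> i j. - (\<i> * g n) * green_term_PQ n x z $ i $ j) *v axis j 1" if "n \<in> {1..N}" for n
    unfolding vec_eq_iff op_H_coefficient_PQ[OF that] mult_vec_axis_nth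
    by (simp only: Re_mat_def vec_lambda_beta Re_derivative_green_term_PQ[OF that assms(4)]) simp
  ultimately show ?thesis
    using assms
    by (simp add: op_H_Psi prop_Re_green_dx3_def prop_Re_green_dz3_def propagating_part_def
        vector_derivative_green_term_x3 vector_derivative_green_term_z3 del: mult_minus_left)
qed

end

theorem lemma4p3:
  fixes a b k r :: real and mi ni :: "nat \<Rightarrow> nat \<times> nat" and M N :: nat
    and D :: "(real^3) set" and x z :: "real^3" and j :: 3
  assumes "a > 0" "b > 0" "k > 0"
    and "bij mi" "mono (waveguide.lam a b mi)"
    and "bij_betw ni {1..} ({1..} \<times> {1..})" "mono_on {1..} (waveguide.mu a b ni)"
    and "\<And>m. k\<^sup>2 \<noteq> (waveguide.lam a b mi m)\<^sup>2"
    and "\<And>n. n \<ge> 1 \<Longrightarrow> k\<^sup>2 \<noteq> (waveguide.mu a b ni n)\<^sup>2"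
    and "waveguide.lam a b mi M < k" "k < waveguide.lam a b mi (Suc M)"
    and "N = 0 \<or> waveguide.mu a b ni N < k" "k < waveguide.mu a b ni (Suc N)"
    and "r < 0"
    and "bounded D" "lipschitz_domain D" "D \<subseteq> waveguide.guide a b"
    and "\<And>y. y \<in> D \<Longrightarrow> r < y$3"
    and "setdist D (waveguide.slice a b r) > 0"
    and "x \<in> D" "z \<in> waveguide.guide a b" "x$3 \<noteq> z$3"
  shows "waveguide.op_H a b k mi ni r D (\<lambda>y. waveguide.Psi a b k mi ni M N y z *v axis j 1) x =
    (if x$3 < z$3 then waveguide.prop_Re_green_dx3 a b k mi ni M N x z j
     else waveguide.prop_Re_green_dz3 a b k mi ni M N x z j)"
proof -
  interpret waveguide_modes a b k mi ni M N
    using assms by unfold_locales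
  have "x \<in> guide"
    using assms by blast
  then have "x$3 < 0"
    by (simp add: guide_def)
  with assms show ?thesis
    by (intro op_H_Psi_eq_prop_Re_green) auto
qed

end
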